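(* Let $(G,\omega^+)$ be a symplectic Lie group with symplectic Lie algebra $(\mathfrak g,\omega)$, let $q:\mathfrak g\to\mathfrak g^*$, $q(x)=\omega(x,\cdot)$, and let $\mathcal D(\mathfrak g)=\mathfrak g\oplus\mathfrak g^*$ be the double Lie algebra of $(G,\omega^+)$. Then every Lie group whose Lie algebra is $\mathcal D(\mathfrak g)$ is endowed with a left invariant complex structure, defined by the endomorphism $$J(x,\alpha)=(-q^{-1}(\alpha),\,q(x)),\qquad x\in\mathfrak g,\ \alpha\in\mathfrak g^*,$$ of $\mathcal D(\mathfrak g)$.
   Context: Lie groups and Lie algebras are real and finite-dimensional; $\langle\cdot,\cdot\rangle$ is the evaluation pairing. A symplectic Lie group $(G,\omega^+)$ is a Lie group with a left invariant symplectic form $\omega^+$; with $\omega=\omega^+_\epsilon$ its value at the unit, $(\mathfrak g,\omega)$ is its symplectic Lie algebra. Put $r=q^{-1}:\mathfrak g^*\to\mathfrak g$, regarded as an element of $\wedge^2\mathfrak g$ via $r(\alpha,\beta)=\langle r(\alpha),\beta\rangle$ (it is a solution of the Classical Yang–Baxter Equation). The double Lie algebra of $(G,\omega^+)$ is the double of the Poisson Lie group $(G,r^+-r^-)$, where $r^+$ (resp. $r^-$) is the left (resp. right) invariant bivector field on $G$ with value $r$ at the unit. Explicitly it is $\mathfrak g\oplus\mathfrak g^*$ with bracket $[(x,\alpha),(y,\beta)]=([x,y]+ad^*_\alpha y-ad^*_\beta x,\ [\alpha,\beta]_r+ad^*_x\beta-ad^*_y\alpha)$, where $\langle ad^*_x\alpha,y\rangle=-\langle\alpha,[x,y]\rangle$,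 $[\alpha,\beta]_r=ad^*_{r(\alpha)}\beta-ad^*_{r(\beta)}\alpha$ and $\langle ad^*_\alpha y,\beta\rangle=-\langle[\alpha,\beta]_r,y\rangle$. *)

theory Defs
  imports "HOL-Analysis.Analysis" "HOL-Algebra.Group"
begin

section \<open>Smooth maps between open subsets of normed spaces\<close>

primrec Ck_on :: "nat \<Rightarrow> ('e::real_normed_vector \<Rightarrow> 'f::real_normed_vector) \<Rightarrow> 'e set \<Rightarrow> bool" where
  "Ck_on 0 f S \<longleftrightarrow> continuous_on S f"
| "Ck_on (Suc k) f S \<longleftrightarrow>
     (\<forall>x\<in>S. f differentiable (at x)) \<and> (\<forall>v. Ck_on k (\<lambda>x. frechet_derivative f (at x) v) S)"

definition smooth_on :: "'e set \<Rightarrow> ('e::real_normed_vector \<Rightarrow> 'f::real_normed_vector) \<Rightarrow> bool" where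
  "smooth_on S f \<longleftrightarrow> (\<forall>k. Ck_on k f S)"


section \<open>Smooth manifolds\<close>

text \<open>A chart is a pair of its domain and the coordinate map; values of the coordinate map outside
  the domain are irrelevant. The atlas is not required to be maximal.\<close>

type_synonym ('a, 'e) chart = "'a set \<times> ('a \<Rightarrow> 'e)"

record ('a, 'e) manifold =
  mtop :: "'a topology"
  charts :: "('a, 'e) chart set"

definition chart_inv :: "('a, 'e) chart \<Rightarrow> 'e \<Rightarrow> 'a" where
  "chart_inv c = inv_into (fst c) (snd c)"

definition smooth_manifold :: "('a, 'e::euclidean_space) manifold \<Rightarrow> bool" where
  "smooth_manifold M \<longleftrightarrow>
     Hausdorff_space (mtop M) \<and> second_countable (mtop M) \<and>
     (\<Union>c\<in>charts M. fst c) = topspace (mtop M) \<and>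
     (\<forall>c\<in>charts M. openin (mtop M) (fst c) \<and> open (snd c ` fst c) \<and>
        homeomorphic_map (subtopology (mtop M) (fst c)) (top_of_set (snd c ` fst c)) (snd c)) \<and>
     (\<forall>c\<in>charts M. \<forall>d\<in>charts M. smooth_on (snd c ` (fst c \<inter> fst d)) (snd d \<circ> chart_inv c))"

definition smooth_map ::
    "('a, 'e::euclidean_space) manifold \<Rightarrow> ('b, 'f::euclidean_space) manifold \<Rightarrow> ('a \<Rightarrow> 'b) \<Rightarrow> bool" where
  "smooth_map M N f \<longleftrightarrow>
     continuous_map (mtop M) (mtop N) f \<and>
     (\<forall>c\<in>charts M. \<forall>d\<in>charts N.
        smooth_on (snd c ` {p \<in> fst c. f p \<in> fst d}) (snd d \<circ> f \<circ> chart_inv c))"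

definition smooth_fun :: "('a, 'e::euclidean_space) manifold \<Rightarrow> ('a \<Rightarrow> real) \<Rightarrow> bool" where
  "smooth_fun M f \<longleftrightarrow> (\<forall>c\<in>charts M. smooth_on (snd c ` fst c) (f \<circ> chart_inv c))"

definition prod_manifold :: "('a, 'e) manifold \<Rightarrow> ('b, 'f) manifold \<Rightarrow> ('a \<times> 'b, 'e \<times> 'f) manifold" where
  "prod_manifold M N =
     \<lparr>mtop = prod_topology (mtop M) (mtop N),
      charts = {(fst c \<times> fst d, map_prod (snd c) (snd d)) | c d. c \<in> charts M \<and> d \<in> charts N}\<rparr>"


section \<open>Tangent vectors and vector fields\<close>

text \<open>The tangent space at p is identified with the model space by means of one chart around p,
  chosen once and for all: a tangent vector at p is given by its components in the chart
  chart_at M p. A vector field therefore has type 'a to 'e, and a field of endomorphisms or of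
  bilinear forms has the point as its first argument.\<close>

definition chart_at :: "('a, 'e) manifold \<Rightarrow> 'a \<Rightarrow> ('a, 'e) chart" where
  "chart_at M p = (SOME c. c \<in> charts M \<and> p \<in> fst c)"

definition tangent_map ::
    "('a, 'e::euclidean_space) manifold \<Rightarrow> ('b, 'f::euclidean_space) manifold \<Rightarrow> ('a \<Rightarrow> 'b) \<Rightarrow> 'a \<Rightarrow> 'e \<Rightarrow> 'f" where
  "tangent_map M N f p =
     frechet_derivative (snd (chart_at N (f p)) \<circ> f \<circ> chart_inv (chart_at M p))
       (at (snd (chart_at M p) p))"

definition dir_deriv :: "('a, 'e::euclidean_space) manifold \<Rightarrow> ('a \<Rightarrow> 'e) \<Rightarrow> ('a \<Rightarrow> real) \<Rightarrow> 'a \<Rightarrow> real" where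
  "dir_deriv M X f p =
     frechet_derivative (f \<circ> chart_inv (chart_at M p)) (at (snd (chart_at M p) p)) (X p)"

text \<open>The components of a vector field in an arbitrary chart c, as a function of the coordinates.\<close>

definition vf_rep :: "('a, 'e::euclidean_space) manifold \<Rightarrow> ('a, 'e) chart \<Rightarrow> ('a \<Rightarrow> 'e) \<Rightarrow> 'e \<Rightarrow> 'e" where
  "vf_rep M c X x =
     (let p = chart_inv c x
      in frechet_derivative (snd c \<circ> chart_inv (chart_at M p)) (at (snd (chart_at M p) p)) (X p))"

definition smooth_vf :: "('a, 'e::euclidean_space) manifold \<Rightarrow> ('a \<Rightarrow> 'e) \<Rightarrow> bool" where
  "smooth_vf M X \<longleftrightarrow> (\<forall>c\<in>charts M. smooth_on (snd c ` fst c) (vf_rep M c X))"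

text \<open>The Lie bracket with the sign convention [X,Y] f = X (Y f) - Y (X f); in coordinates,
  DY X - DX Y.\<close>

definition vf_bracket ::
    "('a, 'e::euclidean_space) manifold \<Rightarrow> ('a \<Rightarrow> 'e) \<Rightarrow> ('a \<Rightarrow> 'e) \<Rightarrow> 'a \<Rightarrow> 'e" where
  "vf_bracket M X Y p =
     (let c = chart_at M p
      in frechet_derivative (vf_rep M c Y) (at (snd c p)) (X p)
         - frechet_derivative (vf_rep M c X) (at (snd c p)) (Y p))"


section \<open>Symplectic forms and complex structures\<close>

definition smooth_2form :: "('a, 'e::euclidean_space) manifold \<Rightarrow> ('a \<Rightarrow> 'e \<Rightarrow> 'e \<Rightarrow> real) \<Rightarrow> bool" where
  "smooth_2form M w \<longleftrightarrow>
     (\<forall>p\<in>topspace (mtop M). bilinear (w p) \<and> (\<forall>u. w p u u = 0)) \<and>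
     (\<forall>X Y. smooth_vf M X \<longrightarrow> smooth_vf M Y \<longrightarrow> smooth_fun M (\<lambda>p. w p (X p) (Y p)))"

definition ext_deriv2 ::
    "('a, 'e::euclidean_space) manifold \<Rightarrow> ('a \<Rightarrow> 'e \<Rightarrow> 'e \<Rightarrow> real)
      \<Rightarrow> ('a \<Rightarrow> 'e) \<Rightarrow> ('a \<Rightarrow> 'e) \<Rightarrow> ('a \<Rightarrow> 'e) \<Rightarrow> 'a \<Rightarrow> real" where
  "ext_deriv2 M w X Y Z p =
     dir_deriv M X (\<lambda>p. w p (Y p) (Z p)) p
     - dir_deriv M Y (\<lambda>p. w p (X p) (Z p)) p
     + dir_deriv M Z (\<lambda>p. w p (X p) (Y p)) p
     - w p (vf_bracket M X Y p) (Z p)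
     + w p (vf_bracket M X Z p) (Y p)
     - w p (vf_bracket M Y Z p) (X p)"

definition symplectic_form :: "('a, 'e::euclidean_space) manifold \<Rightarrow> ('a \<Rightarrow> 'e \<Rightarrow> 'e \<Rightarrow> real) \<Rightarrow> bool" where
  "symplectic_form M w \<longleftrightarrow>
     smooth_2form M w \<and>
     (\<forall>p\<in>topspace (mtop M). \<forall>u. (\<forall>v. w p u v = 0) \<longrightarrow> u = 0) \<and>
     (\<forall>X Y Z. smooth_vf M X \<longrightarrow> smooth_vf M Y \<longrightarrow> smooth_vf M Z \<longrightarrow>
        (\<forall>p\<in>topspace (mtop M). ext_deriv2 M w X Y Z p = 0))"

definition almost_complex_structure :: "('a, 'e::euclidean_space) manifold \<Rightarrow> ('a \<Rightarrow> 'e \<Rightarrow> 'e) \<Rightarrow> bool" where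
  "almost_complex_structure M J \<longleftrightarrow>
     (\<forall>p\<in>topspace (mtop M). linear (J p) \<and> (\<forall>u. J p (J p u) = - u)) \<and>
     (\<forall>X. smooth_vf M X \<longrightarrow> smooth_vf M (\<lambda>p. J p (X p)))"

definition nijenhuis ::
    "('a, 'e::euclidean_space) manifold \<Rightarrow> ('a \<Rightarrow> 'e \<Rightarrow> 'e) \<Rightarrow> ('a \<Rightarrow> 'e) \<Rightarrow> ('a \<Rightarrow> 'e) \<Rightarrow> 'a \<Rightarrow> 'e" where
  "nijenhuis M J X Y p =
     vf_bracket M (\<lambda>p. J p (X p)) (\<lambda>p. J p (Y p)) p
     - J p (vf_bracket M (\<lambda>p. J p (X p)) Y p)
     - J p (vf_bracket M X (\<lambda>p. J p (Y p)) p)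
     - vf_bracket M X Y p"

text \<open>A complex structure is understood as an integrable almost complex structure, that is, one
  with vanishing Nijenhuis tensor.\<close>

definition complex_structure :: "('a, 'e::euclidean_space) manifold \<Rightarrow> ('a \<Rightarrow> 'e \<Rightarrow> 'e) \<Rightarrow> bool" where
  "complex_structure M J \<longleftrightarrow>
     almost_complex_structure M J \<and>
     (\<forall>X Y. smooth_vf M X \<longrightarrow> smooth_vf M Y \<longrightarrow>
        (\<forall>p\<in>topspace (mtop M). nijenhuis M J X Y p = 0))"


section \<open>Lie groups and left invariant tensors\<close>

definition lie_group :: "('a, 'm) monoid_scheme \<Rightarrow> ('a, 'e::euclidean_space) manifold \<Rightarrow> bool" where
  "lie_group G M \<longleftrightarrow>
     group G \<and> smooth_manifold M \<and> topspace (mtop M) = carrier G \<and>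
     smooth_map (prod_manifold M M) M (\<lambda>(g, h). g \<otimes>\<^bsub>G\<^esub> h) \<and>
     smooth_map M M (\<lambda>g. inv\<^bsub>G\<^esub> g)"

definition dL :: "('a, 'm) monoid_scheme \<Rightarrow> ('a, 'e::euclidean_space) manifold \<Rightarrow> 'a \<Rightarrow> 'a \<Rightarrow> 'e \<Rightarrow> 'e" where
  "dL G M g h = tangent_map M M (\<lambda>k. g \<otimes>\<^bsub>G\<^esub> k) h"

definition left_vf :: "('a, 'm) monoid_scheme \<Rightarrow> ('a, 'e::euclidean_space) manifold \<Rightarrow> 'e \<Rightarrow> 'a \<Rightarrow> 'e" where
  "left_vf G M u g = dL G M g \<one>\<^bsub>G\<^esub> u"

text \<open>The Lie algebra of G is the tangent space at the unit, i.e. the type 'e, with this bracket.\<close>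

definition lie_algebra_bracket ::
    "('a, 'm) monoid_scheme \<Rightarrow> ('a, 'e::euclidean_space) manifold \<Rightarrow> 'e \<Rightarrow> 'e \<Rightarrow> 'e" where
  "lie_algebra_bracket G M u v = vf_bracket M (left_vf G M u) (left_vf G M v) \<one>\<^bsub>G\<^esub>"

definition symplectic_lie_group ::
    "('a, 'm) monoid_scheme \<Rightarrow> ('a, 'e::euclidean_space) manifold \<Rightarrow> ('a \<Rightarrow> 'e \<Rightarrow> 'e \<Rightarrow> real) \<Rightarrow> bool" where
  "symplectic_lie_group G M w \<longleftrightarrow>
     lie_group G M \<and> symplectic_form M w \<and>
     (\<forall>g\<in>carrier G. \<forall>h\<in>carrier G. \<forall>u v.
        w (g \<otimes>\<^bsub>G\<^esub> h) (dL G M g h u) (dL G M g h v) = w h u v)"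

definition left_invariant_complex_structure ::
    "('a, 'm) monoid_scheme \<Rightarrow> ('a, 'e::euclidean_space) manifold \<Rightarrow> ('a \<Rightarrow> 'e \<Rightarrow> 'e) \<Rightarrow> bool" where
  "left_invariant_complex_structure G M J \<longleftrightarrow>
     complex_structure M J \<and>
     (\<forall>g\<in>carrier G. \<forall>h\<in>carrier G. \<forall>u. J (g \<otimes>\<^bsub>G\<^esub> h) (dL G M g h u) = dL G M g h (J h u))"

text \<open>The field of endomorphisms obtained from an endomorphism of the Lie algebra by left
  translations.\<close>

definition left_endo_field ::
    "('a, 'm) monoid_scheme \<Rightarrow> ('a, 'e::euclidean_space) manifold \<Rightarrow> ('e \<Rightarrow> 'e) \<Rightarrow> 'a \<Rightarrow> 'e \<Rightarrow> 'e" where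
  "left_endo_field G M A g u = dL G M g \<one>\<^bsub>G\<^esub> (A (dL G M (inv\<^bsub>G\<^esub> g) g u))"


section \<open>The double Lie algebra of a symplectic Lie group\<close>

text \<open>Here br is the Lie bracket on 'g, the dual of 'g is the type of bounded linear functionals,
  and r is a linear map from the dual to 'g.\<close>

definition flat :: "('g::euclidean_space \<Rightarrow> 'g \<Rightarrow> real) \<Rightarrow> 'g \<Rightarrow> ('g \<Rightarrow>\<^sub>L real)" where
  "flat w x = Blinfun (\<lambda>y. w x y)"

definition coad :: "('g::euclidean_space \<Rightarrow> 'g \<Rightarrow> 'g) \<Rightarrow> 'g \<Rightarrow> ('g \<Rightarrow>\<^sub>L real) \<Rightarrow> ('g \<Rightarrow>\<^sub>L real)" where
  "coad br x \<alpha> = Blinfun (\<lambda>y. - blinfun_apply \<alpha> (br x y))"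

definition dual_bracket ::
    "('g::euclidean_space \<Rightarrow> 'g \<Rightarrow> 'g) \<Rightarrow> (('g \<Rightarrow>\<^sub>L real) \<Rightarrow> 'g)
      \<Rightarrow> ('g \<Rightarrow>\<^sub>L real) \<Rightarrow> ('g \<Rightarrow>\<^sub>L real) \<Rightarrow> ('g \<Rightarrow>\<^sub>L real)" where
  "dual_bracket br r \<alpha> \<beta> = coad br (r \<alpha>) \<beta> - coad br (r \<beta>) \<alpha>"

definition dual_coad ::
    "('g::euclidean_space \<Rightarrow> 'g \<Rightarrow> 'g) \<Rightarrow> (('g \<Rightarrow>\<^sub>L real) \<Rightarrow> 'g) \<Rightarrow> ('g \<Rightarrow>\<^sub>L real) \<Rightarrow> 'g \<Rightarrow> 'g" where
  "dual_coad br r \<alpha> y =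
     (THE z. \<forall>\<beta>. blinfun_apply \<beta> z = - blinfun_apply (dual_bracket br r \<alpha> \<beta>) y)"

definition double_bracket ::
    "('g::euclidean_space \<Rightarrow> 'g \<Rightarrow> 'g) \<Rightarrow> (('g \<Rightarrow>\<^sub>L real) \<Rightarrow> 'g)
      \<Rightarrow> 'g \<times> ('g \<Rightarrow>\<^sub>L real) \<Rightarrow> 'g \<times> ('g \<Rightarrow>\<^sub>L real) \<Rightarrow> 'g \<times> ('g \<Rightarrow>\<^sub>L real)" where
  "double_bracket br r = (\<lambda>(x, \<alpha>) (y, \<beta>).
     (br x y + dual_coad br r \<alpha> y - dual_coad br r \<beta> x,
      dual_bracket br r \<alpha> \<beta> + coad br x \<beta> - coad br y \<alpha>))"

definition symplectic_double_bracket ::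
    "('a, 'm) monoid_scheme \<Rightarrow> ('a, 'g::euclidean_space) manifold \<Rightarrow> ('a \<Rightarrow> 'g \<Rightarrow> 'g \<Rightarrow> real)
      \<Rightarrow> 'g \<times> ('g \<Rightarrow>\<^sub>L real) \<Rightarrow> 'g \<times> ('g \<Rightarrow>\<^sub>L real) \<Rightarrow> 'g \<times> ('g \<Rightarrow>\<^sub>L real)" where
  "symplectic_double_bracket G M w =
     double_bracket (lie_algebra_bracket G M) (inv_into UNIV (flat (w \<one>\<^bsub>G\<^esub>)))"

definition double_J ::
    "('g::euclidean_space \<Rightarrow> 'g \<Rightarrow> real) \<Rightarrow> 'g \<times> ('g \<Rightarrow>\<^sub>L real) \<Rightarrow> 'g \<times> ('g \<Rightarrow>\<^sub>L real)" where
  "double_J w = (\<lambda>(x, \<alpha>). (- inv_into UNIV (flat w) \<alpha>, flat w x))"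

end

theory Submission
  imports Defs
begin

text \<open>On the Lie algebra side, identify the dual with the Lie algebra by means of the symplectic form.
  The coadjoint action becomes the left symmetric product x.y with [x,y] = x.y - y.x (this is the cocycle
  identity), the double bracket becomes
  [(x,a),(y,b)] = ([x,y] + a.y - b.x, [a,b] + x.b - y.a), and J becomes (x,a) \<mapsto> (-a,x), so that
  its torsion vanishes by expanding; the Jacobi identity plays no role.

  On the group side, write vector fields as X = E \<xi> with E the frame of left invariant fields and \<xi>
  a function with values in the Lie algebra. Then
  [E \<xi>, E \<eta>] = E ([\<xi>,\<eta>] + d\<eta>(X) - d\<xi>(Y)), and since the left invariant J acts on \<xi> by a constant
  endomorphism A, all derivatives cancel in the Nijenhuis tensor, which is therefore the torsion of A.\<close>

section \<open>Calculus of smooth maps\<close>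

text \<open>Two points shape the geometry. A tangent vector at p is stored in the components of
  \<open>chart_at M p\<close>, a choice with no regularity in p, so nothing smooth can be said about
  raw components: every argument first converts them to one fixed chart by
  \<open>chart_coords\<close>. Secondly, the bracket of the Lie algebra is taken at the unit, while
  the Nijenhuis tensor is needed at every p. Moving the bracket of two left invariant fields from
  the unit to p differentiates a left translation twice; the second-order terms cancel by the
  symmetry of second derivatives, derived below for iterated \<open>frechet_derivative\<close>. The
  cocycle identity comes from evaluating the exterior derivative of w on left invariant fields: left
  invariance makes all pairings of such fields constant, so only the bracket terms of
  \<open>ext_deriv2\<close> survive. The torsion vanishes for a structural reason. Let s(x,a) = x +
  a act on both components by the left symmetric product. Then the double bracket of u and v is
  s(u).v - s(v).u, and J commutes with this action because it only permutes the components up to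
  sign.\<close>

lemma Ck_on_cong:
  assumes "open S" "Ck_on k f S" "\<And>x. x \<in> S \<Longrightarrow> f x = g x"
  shows "Ck_on k g S"
  using assms(2,3)
proof (induction k arbitrary: f g)
  case 0
  then show ?case
    using continuous_on_cong by force
next
  case (Suc k)
  \<comment> \<open>\<open>Ck_on\<close> takes derivatives along the full filter
    \<open>at x\<close>, so equality on S reaches them only because S is open.\<close>
  have d: "g differentiable (at x)" "frechet_derivative f (at x) = frechet_derivative g (at x)"
    if "x \<in> S" for x
  proof -
    have f: "f differentiable (at x)"
      using Suc.prems that by simp
    then have "(g has_derivative frechet_derivative f (at x)) (at x)"
      using has_derivative_transform_within_open[OF _ assms(1) that] Suc.prems(2)
        frechet_derivative_works by blast
    then show "g differentiable (at x)" "frechet_derivative f (at x) = frechet_derivative g (at x)"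
      by (auto simp: differentiable_def dest: frechet_derivative_at)
  qed
  moreover have "Ck_on k (\<lambda>x. frechet_derivative g (at x) v) S" for v
    by (rule Suc.IH[of "\<lambda>x. frechet_derivative f (at x) v"]) (use Suc.prems d in auto)
  ultimately show ?case
    by simp
qed

lemma Ck_on_SucD: "Ck_on (Suc k) f S \<Longrightarrow> Ck_on k f S"
proof (induction k arbitrary: f)
  case 0
  then show ?case
    by (auto intro!: continuous_at_imp_continuous_on differentiable_imp_continuous_within)
next
  case (Suc k)
  then show ?case
    by (metis Ck_on.simps(2))
qed

lemma Ck_on_local:
  assumes "\<And>x. x \<in> S \<Longrightarrow> \<exists>T. open T \<and> x \<in> T \<and> Ck_on k f T"
  shows "Ck_on k f S"
  using assms
proof (induction k arbitrary: f)
  case 0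
  show ?case
    unfolding Ck_on.simps
  proof (rule continuous_at_imp_continuous_on, rule ballI)
    fix x assume "x \<in> S"
    from 0[OF this] obtain T where "open T" "x \<in> T" "continuous_on T f"
      by auto
    then show "isCont f x"
      by (simp add: continuous_on_eq_continuous_at)
  qed
next
  case (Suc k)
  have "f differentiable (at x)" if "x \<in> S" for x
    using Suc.prems[OF that] by auto
  moreover have "Ck_on k (\<lambda>x. frechet_derivative f (at x) v) S" for v
  proof (rule Suc.IH)
    fix x assume "x \<in> S"
    then show "\<exists>T. open T \<and> x \<in> T \<and> Ck_on k (\<lambda>x. frechet_derivative f (at x) v) T"
      using Suc.prems[of x] by auto
  qed
  ultimately show ?case
    by simp
qed

lemma Ck_on_const: "Ck_on k (\<lambda>x. c) S"
  by (induction k arbitrary: c) auto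

lemma frechet_derivative_bounded_linear_compose:
  assumes "bounded_linear L" "f differentiable (at x)"
  shows "(\<lambda>x. L (f x)) differentiable (at x)"
    and "frechet_derivative (\<lambda>x. L (f x)) (at x) v = L (frechet_derivative f (at x) v)"
proof -
  have *: "((\<lambda>x. L (f x)) has_derivative (\<lambda>v. L (frechet_derivative f (at x) v))) (at x)"
    using bounded_linear.has_derivative[OF assms(1)] assms(2) frechet_derivative_works by blast
  then show "(\<lambda>x. L (f x)) differentiable (at x)"
    "frechet_derivative (\<lambda>x. L (f x)) (at x) v = L (frechet_derivative f (at x) v)"
    by (auto simp: differentiable_def frechet_derivative_at[symmetric] dest: frechet_derivative_at)
qed

lemma Ck_on_bounded_linear:
  assumes "open S" "bounded_linear L" "Ck_on k f S"
  shows "Ck_on k (\<lambda>x. L (f x)) S"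
  using assms(3)
proof (induction k arbitrary: f)
  case 0
  then show ?case
    using bounded_linear.continuous_on[OF assms(2)] by simp
next
  case (Suc k)
  have "Ck_on k (\<lambda>x. frechet_derivative (\<lambda>x. L (f x)) (at x) v) S" for v
    by (rule Ck_on_cong[OF assms(1) Suc.IH[of "\<lambda>x. frechet_derivative f (at x) v"]])
      (use Suc.prems in \<open>auto simp: frechet_derivative_bounded_linear_compose[OF assms(2)]\<close>)
  then show ?case
    using Suc.prems by (auto intro: frechet_derivative_bounded_linear_compose[OF assms(2)])
qed

lemma Ck_on_ident: "open S \<Longrightarrow> Ck_on k (\<lambda>x. x) S"
  by (cases k) (auto simp: Ck_on_const)

lemma Ck_on_add:
  assumes "open S" "Ck_on k f S" "Ck_on k g S"
  shows "Ck_on k (\<lambda>x. f x + g x) S"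
  using assms(2,3)
proof (induction k arbitrary: f g)
  case 0
  then show ?case
    by (auto intro: continuous_on_add)
next
  case (Suc k)
  have d: "frechet_derivative (\<lambda>x. f x + g x) (at x) v =
      frechet_derivative f (at x) v + frechet_derivative g (at x) v" if "x \<in> S" for x v
  proof -
    have "((\<lambda>x. f x + g x) has_derivative
        (\<lambda>v. frechet_derivative f (at x) v + frechet_derivative g (at x) v)) (at x)"
      using Suc.prems that by (auto intro!: has_derivative_add simp: frechet_derivative_works[symmetric])
    then show ?thesis
      by (simp add: frechet_derivative_at[symmetric])
  qed
  have "Ck_on k (\<lambda>x. frechet_derivative (\<lambda>x. f x + g x) (at x) v) S" for v
    by (rule Ck_on_cong[OF assms(1) Suc.IH[of "\<lambda>x. frechet_derivative f (at x) v" "\<lambda>x. frechet_derivative g (at x) v"]])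
      (use Suc.prems d in auto)
  then show ?case
    using Suc.prems by (auto intro: differentiable_add)
qed

lemma Ck_on_sum:
  "open S \<Longrightarrow> (\<And>i. i \<in> I \<Longrightarrow> Ck_on k (f i) S) \<Longrightarrow> Ck_on k (\<lambda>x. \<Sum>i\<in>I. f i x) S"
proof (induction I rule: infinite_finite_induct)
  case (insert x F)
  then show ?case
    by (simp add: Ck_on_add)
qed (auto simp: Ck_on_const)

lemma Ck_on_scaleR:
  fixes f :: "_ \<Rightarrow> real"
  assumes "open S" "Ck_on k f S" "Ck_on k g S"
  shows "Ck_on k (\<lambda>x. f x *\<^sub>R g x) S"
  using assms(2,3)
proof (induction k arbitrary: f g)
  case 0
  then show ?case
    by (auto intro: continuous_on_scaleR)
next
  case (Suc k)
  have h: "((\<lambda>x. f x *\<^sub>R g x) has_derivative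
        (\<lambda>v. f x *\<^sub>R frechet_derivative g (at x) v + frechet_derivative f (at x) v *\<^sub>R g x)) (at x)"
    if "x \<in> S" for x
    using Suc.prems that by (auto intro!: has_derivative_scaleR simp: frechet_derivative_works[symmetric])
  have d: "frechet_derivative (\<lambda>x. f x *\<^sub>R g x) (at x) v =
      f x *\<^sub>R frechet_derivative g (at x) v + frechet_derivative f (at x) v *\<^sub>R g x"
    if "x \<in> S" for x v
    by (rule fun_cong[OF frechet_derivative_at[OF h[OF that]], symmetric])
  \<comment> \<open>In each summand one factor is undifferentiated and of class
    \<open>Suc k\<close>; \<open>Ck_on_SucD\<close> lowers it to the class of the other, so the
    induction hypothesis covers both products.\<close>
  have "Ck_on k (\<lambda>x. f x *\<^sub>R frechet_derivative g (at x) v + frechet_derivative f (at x) v *\<^sub>R g x) S" for v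
    using Suc by (intro Ck_on_add[OF assms(1)] Suc.IH) (auto intro: Ck_on_SucD)
  then have "Ck_on k (\<lambda>x. frechet_derivative (\<lambda>x. f x *\<^sub>R g x) (at x) v) S" for v
    by (rule Ck_on_cong[OF assms(1)]) (simp add: d)
  then show ?case
    using h by (auto simp: differentiable_def)
qed

lemma linear_euclidean_expansion:
  fixes L :: "'e::euclidean_space \<Rightarrow> 'f::real_vector"
  assumes "linear L"
  shows "L v = (\<Sum>b\<in>Basis. (v \<bullet> b) *\<^sub>R L b)"
proof -
  have "L v = L (\<Sum>b\<in>Basis. (v \<bullet> b) *\<^sub>R b)"
    by (simp add: euclidean_representation)
  also have "\<dots> = (\<Sum>b\<in>Basis. (v \<bullet> b) *\<^sub>R L b)"
    using assms by (simp add: linear_sum linear_scale)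
  finally show ?thesis .
qed

text \<open>Smoothness of L is known for each fixed v only. Expanding the argument in the finite
  basis turns that into smoothness for a moving argument.\<close>

lemma Ck_on_linear_apply:
  fixes U :: "'e::real_normed_vector \<Rightarrow> 'f::euclidean_space" and L :: "'e \<Rightarrow> 'f \<Rightarrow> 'h::real_normed_vector"
  assumes "open S" "\<And>x. x \<in> S \<Longrightarrow> linear (L x)" "\<And>v. Ck_on k (\<lambda>x. L x v) S" "Ck_on k U S"
  shows "Ck_on k (\<lambda>x. L x (U x)) S"
proof -
  have "Ck_on k (\<lambda>x. \<Sum>b\<in>Basis. (U x \<bullet> b) *\<^sub>R L x b) S"
    using assms by (intro Ck_on_sum Ck_on_scaleR Ck_on_bounded_linear[of S "\<lambda>y. y \<bullet> _" _ U])
      (auto intro: bounded_linear_inner_left)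
  then show ?thesis
    by (rule Ck_on_cong[OF assms(1)]) (use linear_euclidean_expansion[OF assms(2)] in auto)
qed

lemma Ck_on_compose:
  fixes f :: "'e::real_normed_vector \<Rightarrow> 'f::euclidean_space" and g :: "'f \<Rightarrow> 'h::real_normed_vector"
  assumes "open S" "f ` S \<subseteq> T" "Ck_on k f S" "Ck_on k g T"
  shows "Ck_on k (g \<circ> f) S"
  using assms(3,4)
proof (induction k arbitrary: g)
  case 0
  then show ?case
    using assms(2) continuous_on_compose2[of T g S f] by (simp add: o_def)
next
  case (Suc k)
  have df: "f differentiable (at x)" and dg: "g differentiable (at (f x))" if "x \<in> S" for x
    using Suc.prems assms(2) that by auto
  \<comment> \<open>The chain rule gives a linear map depending on x, applied to a vector depending
    on x. For a fixed vector the induction hypothesis applies to the derivative of g with the same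
    f, which is why only g varies in the induction.\<close>
  have "Ck_on k (\<lambda>x. frechet_derivative g (at (f x)) (frechet_derivative f (at x) v)) S" for v
  proof (rule Ck_on_linear_apply[OF assms(1)])
    show "Ck_on k (\<lambda>x. frechet_derivative g (at (f x)) u) S" for u
      using Suc.IH[of "\<lambda>y. frechet_derivative g (at y) u"] Suc.prems Ck_on_SucD[OF Suc.prems(1)]
      by (simp add: o_def)
  qed (use Suc.prems dg in \<open>auto intro: linear_frechet_derivative\<close>)
  then have "Ck_on k (\<lambda>x. frechet_derivative (g \<circ> f) (at x) v) S" for v
    by (rule Ck_on_cong[OF assms(1)]) (simp add: frechet_derivative_compose df dg)
  then show ?case
    using df dg unfolding Ck_on.simps by (intro conjI ballI allI differentiable_chain_at) auto
qed

lemma smooth_on_cong: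
  "open S \<Longrightarrow> smooth_on S f \<Longrightarrow> (\<And>x. x \<in> S \<Longrightarrow> f x = g x) \<Longrightarrow> smooth_on S g"
  unfolding smooth_on_def by (intro allI, rule Ck_on_cong[of S _ f]) auto

lemma smooth_on_local:
  "(\<And>x. x \<in> S \<Longrightarrow> \<exists>T. open T \<and> x \<in> T \<and> smooth_on T f) \<Longrightarrow> smooth_on S f"
  unfolding smooth_on_def by (rule allI, rule Ck_on_local) blast

lemma smooth_on_differentiable: "smooth_on S f \<Longrightarrow> x \<in> S \<Longrightarrow> f differentiable (at x)"
  unfolding smooth_on_def by (drule spec[of _ 1]) simp

lemma smooth_on_frechet_derivative: "smooth_on S f \<Longrightarrow> smooth_on S (\<lambda>x. frechet_derivative f (at x) v)"
  unfolding smooth_on_def by (rule allI, drule_tac x = "Suc k" in spec) simp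

lemma smooth_on_imp_continuous_on: "smooth_on S f \<Longrightarrow> continuous_on S f"
  unfolding smooth_on_def by (drule spec[of _ 0]) simp

lemma smooth_on_ident: "open S \<Longrightarrow> smooth_on S (\<lambda>x. x)"
  unfolding smooth_on_def by (simp add: Ck_on_ident)

lemma smooth_on_bounded_linear:
  "open S \<Longrightarrow> bounded_linear L \<Longrightarrow> smooth_on S f \<Longrightarrow> smooth_on S (\<lambda>x. L (f x))"
  unfolding smooth_on_def by (intro allI, rule Ck_on_bounded_linear[of S L _ f]) auto

lemma smooth_on_linear_apply:
  fixes U :: "'e::real_normed_vector \<Rightarrow> 'f::euclidean_space" and L :: "'e \<Rightarrow> 'f \<Rightarrow> 'h::real_normed_vector"
  shows "open S \<Longrightarrow> (\<And>x. x \<in> S \<Longrightarrow> linear (L x)) \<Longrightarrow> (\<And>v. smooth_on S (\<lambda>x. L x v)) \<Longrightarrow> smooth_on S U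
    \<Longrightarrow> smooth_on S (\<lambda>x. L x (U x))"
  unfolding smooth_on_def by (intro allI, rule Ck_on_linear_apply[of S L _ U]) auto

lemma smooth_on_compose:
  fixes f :: "'e::real_normed_vector \<Rightarrow> 'f::euclidean_space"
  shows "open S \<Longrightarrow> smooth_on S f \<Longrightarrow> smooth_on T g \<Longrightarrow> f ` S \<subseteq> T \<Longrightarrow> smooth_on S (\<lambda>x. g (f x))"
  unfolding smooth_on_def using Ck_on_compose[of S f T _ g] by (simp add: o_def)

lemma smooth_on_const: "smooth_on S (\<lambda>x. c)"
  unfolding smooth_on_def by (simp add: Ck_on_const)

lemma smooth_on_Pair:
  assumes "open S" "smooth_on S f" "smooth_on S g"
  shows "smooth_on S (\<lambda>x. (f x, g x))"
proof -
  have 1: "bounded_linear (\<lambda>a. (a, 0))" and 2: "bounded_linear (\<lambda>b. (0, b))"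
    by (auto intro!: bounded_linear_Pair bounded_linear_ident bounded_linear_zero)
  have "Ck_on k (\<lambda>x. (f x, 0) + (0, g x)) S" for k
  proof (rule Ck_on_add[OF assms(1)])
    show "Ck_on k (\<lambda>x. (f x, 0)) S"
      using Ck_on_bounded_linear[OF assms(1) 1, of k f] assms(2) by (simp add: smooth_on_def)
    show "Ck_on k (\<lambda>x. (0, g x)) S"
      using Ck_on_bounded_linear[OF assms(1) 2, of k g] assms(3) by (simp add: smooth_on_def)
  qed
  then show ?thesis
    by (simp add: smooth_on_def)
qed

text \<open>The product rule for evaluation. It serves to differentiate a vector field written as
  frame times coefficients, and the relation between a left invariant field and its
  translate.\<close>

lemma has_derivative_linear_apply:
  fixes U :: "'e::real_normed_vector \<Rightarrow> 'f::euclidean_space" and L :: "'e \<Rightarrow> 'f \<Rightarrow> 'h::real_normed_vector"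
  assumes "open S" "x \<in> S" "\<And>y. y \<in> S \<Longrightarrow> linear (L y)" "\<And>v. (\<lambda>y. L y v) differentiable (at x)"
    "U differentiable (at x)"
  shows "((\<lambda>y. L y (U y)) has_derivative
    (\<lambda>h. frechet_derivative (\<lambda>y. L y (U x)) (at x) h + L x (frechet_derivative U (at x) h))) (at x)"
proof -
  have U: "((\<lambda>y. U y \<bullet> b) has_derivative (\<lambda>h. frechet_derivative U (at x) h \<bullet> b)) (at x)" for b
    using bounded_linear.has_derivative[OF bounded_linear_inner_left] assms(5) frechet_derivative_works
    by blast
  have L: "((\<lambda>y. L y v) has_derivative (\<lambda>h. frechet_derivative (\<lambda>y. L y v) (at x) h)) (at x)" for v
    using assms(4) frechet_derivative_works by blast
  have exp: "L y v = (\<Sum>b\<in>Basis. (v \<bullet> b) *\<^sub>R L y b)" if "y \<in> S" for y v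
    using that assms(3) linear_euclidean_expansion by blast
  have "((\<lambda>y. \<Sum>b\<in>Basis. (U x \<bullet> b) *\<^sub>R L y b) has_derivative
    (\<lambda>h. \<Sum>b\<in>Basis. (U x \<bullet> b) *\<^sub>R frechet_derivative (\<lambda>y. L y b) (at x) h)) (at x)"
    by (intro has_derivative_sum has_derivative_scaleR_right L)
  then have "((\<lambda>y. L y (U x)) has_derivative
    (\<lambda>h. \<Sum>b\<in>Basis. (U x \<bullet> b) *\<^sub>R frechet_derivative (\<lambda>y. L y b) (at x) h)) (at x)"
    by (rule has_derivative_transform_within_open[OF _ assms(1,2)]) (metis exp)
  then have 1: "frechet_derivative (\<lambda>y. L y (U x)) (at x) =
    (\<lambda>h. \<Sum>b\<in>Basis. (U x \<bullet> b) *\<^sub>R frechet_derivative (\<lambda>y. L y b) (at x) h)"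
    by (simp add: frechet_derivative_at[symmetric])
  have "((\<lambda>y. \<Sum>b\<in>Basis. (U y \<bullet> b) *\<^sub>R L y b) has_derivative
    (\<lambda>h. \<Sum>b\<in>Basis. (U x \<bullet> b) *\<^sub>R frechet_derivative (\<lambda>y. L y b) (at x) h
      + (frechet_derivative U (at x) h \<bullet> b) *\<^sub>R L x b)) (at x)"
    by (intro has_derivative_sum has_derivative_scaleR L U)
  then have "((\<lambda>y. L y (U y)) has_derivative
    (\<lambda>h. \<Sum>b\<in>Basis. (U x \<bullet> b) *\<^sub>R frechet_derivative (\<lambda>y. L y b) (at x) h
      + (frechet_derivative U (at x) h \<bullet> b) *\<^sub>R L x b)) (at x)"
    by (rule has_derivative_transform_within_open[OF _ assms(1,2)]) (metis exp)
  then show ?thesis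
    by (simp add: 1 sum.distrib exp[OF assms(2), of "frechet_derivative U (at x) _"])
qed

text \<open>Used for the linearity of the bracket of the Lie algebra, whose second argument selects
  the left invariant field being differentiated.\<close>

lemma linear_frechet_derivative_family:
  fixes L :: "'e::real_normed_vector \<Rightarrow> 'f::real_vector \<Rightarrow> 'h::real_normed_vector"
  assumes "open S" "x \<in> S" "\<And>y. y \<in> S \<Longrightarrow> linear (L y)" "\<And>v. (\<lambda>y. L y v) differentiable (at x)"
  shows "linear (\<lambda>v. frechet_derivative (\<lambda>y. L y v) (at x) h)"
proof (rule linearI)
  have L: "((\<lambda>y. L y v) has_derivative frechet_derivative (\<lambda>y. L y v) (at x)) (at x)" for v
    using assms(4) frechet_derivative_works by blast
  show "frechet_derivative (\<lambda>y. L y (v + w)) (at x) h =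
      frechet_derivative (\<lambda>y. L y v) (at x) h + frechet_derivative (\<lambda>y. L y w) (at x) h" for v w
  proof -
    have "((\<lambda>y. L y (v + w)) has_derivative (\<lambda>h. frechet_derivative (\<lambda>y. L y v) (at x) h +
        frechet_derivative (\<lambda>y. L y w) (at x) h)) (at x)"
      by (rule has_derivative_transform_within_open[OF has_derivative_add[OF L L] assms(1,2)])
        (simp add: assms(3) linear_add)
    from fun_cong[OF has_derivative_unique[OF L this]] show ?thesis .
  qed
  show "frechet_derivative (\<lambda>y. L y (r *\<^sub>R v)) (at x) h = r *\<^sub>R frechet_derivative (\<lambda>y. L y v) (at x) h" for r v
  proof -
    have "((\<lambda>y. L y (r *\<^sub>R v)) has_derivative (\<lambda>h. r *\<^sub>R frechet_derivative (\<lambda>y. L y v) (at x) h)) (at x)"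
      by (rule has_derivative_transform_within_open[OF has_derivative_scaleR_right[OF L] assms(1,2)])
        (simp add: assms(3) linear_scale)
    from fun_cong[OF has_derivative_unique[OF L this]] show ?thesis .
  qed
qed

lemma frechet_derivative_snd_arg:
  fixes F :: "'p::real_normed_vector \<times> 'q::real_normed_vector \<Rightarrow> 'r::real_normed_vector"
  assumes "F differentiable (at (z, y))"
  shows "frechet_derivative (\<lambda>y. F (z, y)) (at y) v = frechet_derivative F (at (z, y)) (0, v)"
proof -
  have "((\<lambda>y. (z, y)) has_derivative (\<lambda>v. (0, v))) (at y)"
    by (intro has_derivative_Pair has_derivative_const has_derivative_ident)
  from diff_chain_at[OF this, of F "frechet_derivative F (at (z, y))"] assms
  have "((\<lambda>y. F (z, y)) has_derivative (\<lambda>v. frechet_derivative F (at (z, y)) (0, v))) (at y)"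
    by (simp add: o_def frechet_derivative_works)
  then show ?thesis
    using frechet_derivative_at by metis
qed

section \<open>Symmetry of second derivatives\<close>

lemma second_difference_mvt:
  fixes f :: "'e::real_normed_vector \<Rightarrow> real"
  assumes t: "0 < t"
    and S: "\<And>s r. 0 \<le> s \<Longrightarrow> s \<le> t \<Longrightarrow> 0 \<le> r \<Longrightarrow> r \<le> t \<Longrightarrow> x + s *\<^sub>R a + r *\<^sub>R b \<in> S"
    and f: "\<And>y. y \<in> S \<Longrightarrow> f differentiable (at y)"
    and f': "\<And>y. y \<in> S \<Longrightarrow> (\<lambda>z. frechet_derivative f (at z) a) differentiable (at y)"
  obtains s r where "0 < s" "s < t" "0 < r" "r < t"
    "f (x + t *\<^sub>R a + t *\<^sub>R b) - f (x + t *\<^sub>R a) - f (x + t *\<^sub>R b) + f x =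
      t * t * frechet_derivative (\<lambda>z. frechet_derivative f (at z) a) (at (x + s *\<^sub>R a + r *\<^sub>R b)) b"
proof -
  let ?A = "\<lambda>z. frechet_derivative f (at z) a"
  have der: "((\<lambda>s. g (x + s *\<^sub>R u + v)) has_derivative
      (\<lambda>h. frechet_derivative g (at (x + s *\<^sub>R u + v)) (h *\<^sub>R u))) (at s)"
    if "g differentiable (at (x + s *\<^sub>R u + v))" for g :: "'e \<Rightarrow> real" and s u v
  proof -
    have "((\<lambda>s. x + s *\<^sub>R u + v) has_derivative (\<lambda>h. h *\<^sub>R u)) (at s)"
      by (auto intro!: derivative_eq_intros)
    from diff_chain_at[OF this, of g] that show ?thesis
      by (auto simp: o_def frechet_derivative_works)
  qed
  \<comment> \<open>First mean value step, along a, for the difference of f on two opposite sides of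
    the parallelogram. The summand 0 matches the shape of \<open>der\<close> with v = 0.\<close>
  have "\<exists>s\<in>{0<..<t}. (f (x + t *\<^sub>R a + t *\<^sub>R b) - f (x + t *\<^sub>R a + 0)) -
        (f (x + 0 *\<^sub>R a + t *\<^sub>R b) - f (x + 0 *\<^sub>R a + 0)) =
      frechet_derivative f (at (x + s *\<^sub>R a + t *\<^sub>R b)) ((t - 0) *\<^sub>R a)
        - frechet_derivative f (at (x + s *\<^sub>R a + 0)) ((t - 0) *\<^sub>R a)"
  proof (rule mvt_simple[OF t])
    fix s assume "0 \<le> s" "s \<le> t"
    then have "x + s *\<^sub>R a + t *\<^sub>R b \<in> S" "x + s *\<^sub>R a + 0 \<in> S"
      using S[of s t] S[of s 0] t by auto
    then have "((\<lambda>s. f (x + s *\<^sub>R a + t *\<^sub>R b) - f (x + s *\<^sub>R a + 0)) has_derivative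
      (\<lambda>h. frechet_derivative f (at (x + s *\<^sub>R a + t *\<^sub>R b)) (h *\<^sub>R a)
        - frechet_derivative f (at (x + s *\<^sub>R a + 0)) (h *\<^sub>R a))) (at s)"
      by (intro has_derivative_diff der f)
    then show "((\<lambda>s. f (x + s *\<^sub>R a + t *\<^sub>R b) - f (x + s *\<^sub>R a + 0)) has_derivative
      (\<lambda>h. frechet_derivative f (at (x + s *\<^sub>R a + t *\<^sub>R b)) (h *\<^sub>R a)
        - frechet_derivative f (at (x + s *\<^sub>R a + 0)) (h *\<^sub>R a))) (at s within {0..t})"
      by (rule has_derivative_at_withinI)
  qed
  then obtain s where s: "0 < s" "s < t" and eq1:
    "f (x + t *\<^sub>R a + t *\<^sub>R b) - f (x + t *\<^sub>R a) - f (x + t *\<^sub>R b) + f x =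
      frechet_derivative f (at (x + s *\<^sub>R a + t *\<^sub>R b)) (t *\<^sub>R a)
        - frechet_derivative f (at (x + s *\<^sub>R a)) (t *\<^sub>R a)"
    by auto
  have lin: "frechet_derivative f (at y) (t *\<^sub>R a) = t * ?A y" if "y \<in> S" for y
    using linear_scale[OF linear_frechet_derivative[OF f[OF that]]] by simp
  \<comment> \<open>Second mean value step, along b, for the derivative of f in direction a; the
    summands are reordered to fit \<open>der\<close>.\<close>
  have "\<exists>r\<in>{0<..<t}. ?A (x + t *\<^sub>R b + s *\<^sub>R a) - ?A (x + 0 *\<^sub>R b + s *\<^sub>R a) =
      frechet_derivative ?A (at (x + r *\<^sub>R b + s *\<^sub>R a)) ((t - 0) *\<^sub>R b)"
  proof (rule mvt_simple[OF t])
    fix r assume "0 \<le> r" "r \<le> t"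
    then have "x + r *\<^sub>R b + s *\<^sub>R a \<in> S"
      using S[of s r] s by (simp add: add_ac)
    then show "((\<lambda>r. ?A (x + r *\<^sub>R b + s *\<^sub>R a)) has_derivative
        (\<lambda>h. frechet_derivative ?A (at (x + r *\<^sub>R b + s *\<^sub>R a)) (h *\<^sub>R b))) (at r within {0..t})"
      by (rule has_derivative_at_withinI[OF der[OF f']])
  qed
  then obtain r where r: "0 < r" "r < t" and eq2:
    "?A (x + s *\<^sub>R a + t *\<^sub>R b) - ?A (x + s *\<^sub>R a) =
      frechet_derivative ?A (at (x + s *\<^sub>R a + r *\<^sub>R b)) (t *\<^sub>R b)"
    by (auto simp: add_ac)
  have "x + s *\<^sub>R a + r *\<^sub>R b \<in> S" "x + s *\<^sub>R a + t *\<^sub>R b \<in> S" "x + s *\<^sub>R a \<in> S"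
    using S[of s r] S[of s t] S[of s 0] s r by auto
  moreover from this have "frechet_derivative ?A (at (x + s *\<^sub>R a + r *\<^sub>R b)) (t *\<^sub>R b) =
      t * frechet_derivative ?A (at (x + s *\<^sub>R a + r *\<^sub>R b)) b"
    using linear_scale[OF linear_frechet_derivative[OF f']] by simp
  ultimately show thesis
    using that[OF s r] eq1 eq2 lin by (simp add: right_diff_distrib[symmetric])
qed

lemma symmetric_second_derivative_real:
  fixes f :: "'e::real_normed_vector \<Rightarrow> real"
  assumes "open S" "x \<in> S" "smooth_on S f"
  shows "frechet_derivative (\<lambda>y. frechet_derivative f (at y) a) (at x) b =
    frechet_derivative (\<lambda>y. frechet_derivative f (at y) b) (at x) a" (is "?P x = ?Q x")
proof (rule ccontr)
  assume neq: "?P x \<noteq> ?Q x"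
  \<comment> \<open>Half the gap: a number within e of \<open>?P x\<close> and a number within e of
    \<open>?Q x\<close> cannot coincide.\<close>
  define e where "e = \<bar>?P x - ?Q x\<bar> / 2"
  have e: "e > 0"
    using neq by (simp add: e_def)
  have sm: "smooth_on S (\<lambda>y. frechet_derivative f (at y) u)" for u
    by (intro smooth_on_frechet_derivative assms)
  have cont: "isCont ?P x" "isCont ?Q x"
    using smooth_on_imp_continuous_on[OF smooth_on_frechet_derivative[OF sm]] assms
    by (auto simp: continuous_on_eq_continuous_at)
  obtain d1 where d1: "d1 > 0" "\<And>y. dist y x < d1 \<Longrightarrow> dist (?P y) (?P x) < e"
    using cont(1)[unfolded continuous_at_eps_delta, rule_format, OF e] by blast
  obtain d2 where d2: "d2 > 0" "\<And>y. dist y x < d2 \<Longrightarrow> dist (?Q y) (?Q x) < e"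
    using cont(2)[unfolded continuous_at_eps_delta, rule_format, OF e] by blast
  obtain d3 where d3: "d3 > 0" "ball x d3 \<subseteq> S"
    using assms openE by blast
  define d where "d = min d1 (min d2 d3)"
  have d: "d > 0"
    using d1 d2 d3 by (simp add: d_def)
  \<comment> \<open>Scaled so that the whole parallelogram spanned by t a and t b at x lies within d
    / 2 of x; the 1 keeps the denominator positive when a = b = 0.\<close>
  define t where "t = d / (2 * (norm a + norm b + 1))"
  have na: "norm a + norm b + 1 \<noteq> 0"
    using norm_ge_zero[of a] norm_ge_zero[of b] by linarith
  have t: "t > 0"
    using d by (simp add: t_def add_nonneg_pos)
  have near: "dist (x + s *\<^sub>R a + r *\<^sub>R b) x < d" if "0 \<le> s" "s \<le> t" "0 \<le> r" "r \<le> t" for s r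
  proof -
    have "dist (x + s *\<^sub>R a + r *\<^sub>R b) x = norm (s *\<^sub>R a + r *\<^sub>R b)"
      by (simp add: dist_norm)
    also have "\<dots> \<le> s * norm a + r * norm b"
      using that norm_triangle_ineq[of "s *\<^sub>R a" "r *\<^sub>R b"] by simp
    also have "\<dots> \<le> t * norm a + t * norm b"
      using that by (intro add_mono mult_right_mono) auto
    also have "\<dots> \<le> t * (norm a + norm b + 1)"
      using t by (simp add: algebra_simps)
    also have "\<dots> = d / 2"
      using na unfolding t_def by (metis (no_types) mult.commute mult_divide_mult_cancel_left times_divide_eq_left)
    finally show ?thesis
      using d by simp
  qed
  have inS: "x + s *\<^sub>R a + r *\<^sub>R b \<in> S" if "0 \<le> s" "s \<le> t" "0 \<le> r" "r \<le> t" for s r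
    using near[OF that] d3(2) by (auto simp: d_def dist_commute)
  have diff: "f differentiable (at y)" "(\<lambda>z. frechet_derivative f (at z) u) differentiable (at y)"
    if "y \<in> S" for y u
    using smooth_on_differentiable assms sm that by blast+
  obtain s r where 1: "0 < s" "s < t" "0 < r" "r < t"
    "f (x + t *\<^sub>R a + t *\<^sub>R b) - f (x + t *\<^sub>R a) - f (x + t *\<^sub>R b) + f x =
      t * t * ?P (x + s *\<^sub>R a + r *\<^sub>R b)"
    using second_difference_mvt[OF t inS, of f] diff by blast
  \<comment> \<open>The second difference is symmetric in a and b, so exchanging them expresses the
    same number by \<open>?Q\<close>.\<close>
  obtain s' r' where 2: "0 < s'" "s' < t" "0 < r'" "r' < t"
    "f (x + t *\<^sub>R b + t *\<^sub>R a) - f (x + t *\<^sub>R b) - f (x + t *\<^sub>R a) + f x =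
      t * t * ?Q (x + s' *\<^sub>R b + r' *\<^sub>R a)"
  proof (rule second_difference_mvt[OF t, of x b a S f])
    show "x + s *\<^sub>R b + r *\<^sub>R a \<in> S" if "0 \<le> s" "s \<le> t" "0 \<le> r" "r \<le> t" for s r
      using inS[of r s] that by (simp add: algebra_simps)
  qed (use diff in auto)
  have sw: "x + s' *\<^sub>R b + r' *\<^sub>R a = x + r' *\<^sub>R a + s' *\<^sub>R b" "x + t *\<^sub>R b + t *\<^sub>R a = x + t *\<^sub>R a + t *\<^sub>R b"
    by (simp_all add: algebra_simps)
  have "t * t * ?P (x + s *\<^sub>R a + r *\<^sub>R b) = t * t * ?Q (x + r' *\<^sub>R a + s' *\<^sub>R b)"
    using 1(5) 2(5) unfolding sw by linarith
  then have "?P (x + s *\<^sub>R a + r *\<^sub>R b) = ?Q (x + r' *\<^sub>R a + s' *\<^sub>R b)"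
    using t by simp
  moreover have "dist (?P (x + s *\<^sub>R a + r *\<^sub>R b)) (?P x) < e"
    using near[of s r] 1 by (intro d1) (auto simp: d_def)
  moreover have "dist (?Q (x + r' *\<^sub>R a + s' *\<^sub>R b)) (?Q x) < e"
    using near[of r' s'] 2 by (intro d2) (auto simp: d_def)
  ultimately show False
    unfolding e_def dist_real_def by argo
qed

text \<open>The mean value argument is for real values, so the two sides are compared
  componentwise.\<close>

lemma symmetric_second_derivative:
  fixes f :: "'e::real_normed_vector \<Rightarrow> 'f::euclidean_space"
  assumes "open S" "x \<in> S" "smooth_on S f"
  shows "frechet_derivative (\<lambda>y. frechet_derivative f (at y) a) (at x) b =
    frechet_derivative (\<lambda>y. frechet_derivative f (at y) b) (at x) a"
proof (rule euclidean_eqI)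
  fix i :: 'f
  let ?g = "\<lambda>y. f y \<bullet> i"
  have bl: "bounded_linear (\<lambda>y::'f. y \<bullet> i)"
    by (rule bounded_linear_inner_left)
  have g: "smooth_on S ?g"
    using smooth_on_bounded_linear[OF assms(1) bl assms(3)] .
  have 1: "frechet_derivative ?g (at y) u = frechet_derivative f (at y) u \<bullet> i" if "y \<in> S" for y u
    by (rule frechet_derivative_bounded_linear_compose[OF bl smooth_on_differentiable[OF assms(3) that]])
  have "frechet_derivative (\<lambda>y. frechet_derivative ?g (at y) u) (at x) v =
      frechet_derivative (\<lambda>y. frechet_derivative f (at y) u) (at x) v \<bullet> i" for u v
  proof -
    have d: "(\<lambda>y. frechet_derivative f (at y) u) differentiable (at x)"
      using assms smooth_on_differentiable smooth_on_frechet_derivative by blast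
    have "(\<lambda>y. frechet_derivative f (at y) u \<bullet> i) differentiable (at x)"
      by (rule frechet_derivative_bounded_linear_compose[OF bl d])
    then have "frechet_derivative (\<lambda>y. frechet_derivative f (at y) u \<bullet> i) (at x) =
        frechet_derivative (\<lambda>y. frechet_derivative ?g (at y) u) (at x)"
      by (rule frechet_derivative_transform_within_open[OF _ assms(1,2)]) (simp add: 1)
    then show ?thesis
      using frechet_derivative_bounded_linear_compose(2)[OF bl d] by metis
  qed
  then show "frechet_derivative (\<lambda>y. frechet_derivative f (at y) a) (at x) b \<bullet> i =
      frechet_derivative (\<lambda>y. frechet_derivative f (at y) b) (at x) a \<bullet> i"
    using symmetric_second_derivative_real[OF assms(1,2) g, of a b] by metis
qed

section \<open>Charts and tangent maps\<close>

text \<open>The change of components at p from the preferred chart to c, that is, the differential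
  of the transition map.\<close>

definition chart_coords :: "('a, 'e::euclidean_space) manifold \<Rightarrow> ('a, 'e) chart \<Rightarrow> 'a \<Rightarrow> 'e \<Rightarrow> 'e" where
  "chart_coords M c p =
     frechet_derivative (snd c \<circ> chart_inv (chart_at M p)) (at (snd (chart_at M p) p))"

lemma vf_rep_chart_coords: "vf_rep M c X x = chart_coords M c (chart_inv c x) (X (chart_inv c x))"
  by (simp add: vf_rep_def chart_coords_def Let_def)

lemma chart_at_charts:
  assumes "smooth_manifold M" "p \<in> topspace (mtop M)"
  shows "chart_at M p \<in> charts M" "p \<in> fst (chart_at M p)"
proof -
  have "\<exists>c. c \<in> charts M \<and> p \<in> fst c"
    using assms unfolding smooth_manifold_def by blast
  from someI_ex[OF this] show "chart_at M p \<in> charts M" "p \<in> fst (chart_at M p)"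
    unfolding chart_at_def by blast+
qed

lemma chart_subset_topspace: "smooth_manifold M \<Longrightarrow> c \<in> charts M \<Longrightarrow> fst c \<subseteq> topspace (mtop M)"
  unfolding smooth_manifold_def by blast

lemma chart_openin: "smooth_manifold M \<Longrightarrow> c \<in> charts M \<Longrightarrow> openin (mtop M) (fst c)"
  unfolding smooth_manifold_def by blast

lemma chart_homeomorphic:
  "smooth_manifold M \<Longrightarrow> c \<in> charts M \<Longrightarrow>
    homeomorphic_map (subtopology (mtop M) (fst c)) (top_of_set (snd c ` fst c)) (snd c)"
  unfolding smooth_manifold_def by blast

lemma chart_inj_on:
  assumes "smooth_manifold M" "c \<in> charts M"
  shows "inj_on (snd c) (fst c)"
  using homeomorphic_imp_injective_map[OF chart_homeomorphic[OF assms]] chart_subset_topspace[OF assms]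
  by (simp add: inf_absorb2)

lemma chart_inv_chart [simp]:
  assumes "smooth_manifold M" "c \<in> charts M" "p \<in> fst c"
  shows "chart_inv c (snd c p) = p"
  using chart_inj_on[OF assms(1,2)] assms(3) by (simp add: chart_inv_def)

lemma open_chart_image:
  assumes "smooth_manifold M" "c \<in> charts M" "openin (mtop M) U" "U \<subseteq> fst c"
  shows "open (snd c ` U)"
proof -
  have "openin (top_of_set (snd c ` fst c)) (snd c ` U)"
    using homeomorphic_imp_open_map[OF chart_homeomorphic[OF assms(1,2)]] assms(3,4)
    by (simp add: open_map_def openin_subtopology_alt image_iff) (metis inf.absorb_iff2)
  moreover have "open (snd c ` fst c)"
    using assms(1,2) unfolding smooth_manifold_def by blast
  ultimately show ?thesis
    using openin_open_trans by blast
qed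

lemma open_chart_range: "smooth_manifold M \<Longrightarrow> c \<in> charts M \<Longrightarrow> open (snd c ` fst c)"
  using open_chart_image chart_openin by blast

lemma openin_chart_preimage:
  assumes "smooth_manifold M" "smooth_manifold N" "smooth_map M N f" "c \<in> charts M" "d \<in> charts N"
  shows "openin (mtop M) {p \<in> fst c. f p \<in> fst d}"
proof -
  have "openin (mtop M) {p \<in> topspace (mtop M). f p \<in> fst d}"
    using assms chart_openin[OF assms(2,5)] openin_continuous_map_preimage
    unfolding smooth_map_def by blast
  then have "openin (mtop M) (fst c \<inter> {p \<in> topspace (mtop M). f p \<in> fst d})"
    using chart_openin[OF assms(1,4)] by blast
  moreover have "fst c \<inter> {p \<in> topspace (mtop M). f p \<in> fst d} = {p \<in> fst c. f p \<in> fst d}"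
    using chart_subset_topspace[OF assms(1,4)] by blast
  ultimately show ?thesis
    by simp
qed

lemma open_local_domain:
  assumes "smooth_manifold M" "smooth_manifold N" "smooth_map M N f" "c \<in> charts M" "d \<in> charts N"
  shows "open (snd c ` {p \<in> fst c. f p \<in> fst d})"
  by (rule open_chart_image[OF assms(1,4) openin_chart_preimage[OF assms]]) blast

lemma smooth_local_rep:
  "smooth_map M N f \<Longrightarrow> c \<in> charts M \<Longrightarrow> d \<in> charts N \<Longrightarrow>
    smooth_on (snd c ` {p \<in> fst c. f p \<in> fst d}) (snd d \<circ> f \<circ> chart_inv c)"
  unfolding smooth_map_def by blast

lemma differentiable_local_rep:
  assumes "smooth_map M N f" "c \<in> charts M" "d \<in> charts N" "p \<in> fst c" "f p \<in> fst d"
  shows "(snd d \<circ> f \<circ> chart_inv c) differentiable (at (snd c p))"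
  by (rule smooth_on_differentiable[OF smooth_local_rep[OF assms(1-3)]]) (use assms in blast)

text \<open>Compatibility of the charts, restated as smoothness of the identity. This makes every
  change of coordinates an instance of the chain rule
  \<open>frechet_local_rep_compose\<close>.\<close>

lemma smooth_map_id:
  assumes "smooth_manifold M"
  shows "smooth_map M M id"
proof -
  have "smooth_on (snd c ` {p \<in> fst c. id p \<in> fst d}) (snd d \<circ> id \<circ> chart_inv c)"
    if "c \<in> charts M" "d \<in> charts M" for c d
  proof -
    have "{p \<in> fst c. id p \<in> fst d} = fst c \<inter> fst d"
      by auto
    then show ?thesis
      using assms that unfolding smooth_manifold_def by auto
  qed
  then show ?thesis
    unfolding smooth_map_def by auto
qed

lemma frechet_local_rep_compose:
  assumes M: "smooth_manifold M1" "smooth_manifold M2"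
    and f: "smooth_map M1 M2 f" and g: "smooth_map M2 M3 g"
    and c: "c \<in> charts M1" "p \<in> fst c" and d: "d \<in> charts M2" "f p \<in> fst d"
    and e: "e \<in> charts M3" "g (f p) \<in> fst e"
  shows "frechet_derivative (snd e \<circ> (g \<circ> f) \<circ> chart_inv c) (at (snd c p)) =
    frechet_derivative (snd e \<circ> g \<circ> chart_inv d) (at (snd d (f p))) \<circ>
    frechet_derivative (snd d \<circ> f \<circ> chart_inv c) (at (snd c p))"
proof -
  let ?F = "snd d \<circ> f \<circ> chart_inv c" and ?G = "snd e \<circ> g \<circ> chart_inv d"
  let ?S = "snd c ` {p \<in> fst c. f p \<in> fst d}"
  have Fp: "?F (snd c p) = snd d (f p)"
    using M c by simp
  have dF: "?F differentiable (at (snd c p))"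
    by (rule differentiable_local_rep[OF f c(1) d(1) c(2) d(2)])
  have dG: "?G differentiable (at (?F (snd c p)))"
    unfolding Fp by (rule differentiable_local_rep[OF g d(1) e(1) d(2) e(2)])
  \<comment> \<open>The two functions are compared where f stays in the domain of d, since there
    \<open>chart_inv d\<close> cancels against \<open>snd d\<close>; this region is open by
    continuity of f.\<close>
  have "frechet_derivative (?G \<circ> ?F) (at (snd c p)) =
      frechet_derivative (snd e \<circ> (g \<circ> f) \<circ> chart_inv c) (at (snd c p))"
  proof (rule frechet_derivative_transform_within_open)
    show "(?G \<circ> ?F) differentiable (at (snd c p))"
      using dF dG differentiable_chain_at by blast
    show "open ?S"
      by (rule open_local_domain[OF M f c(1) d(1)])
    show "snd c p \<in> ?S"
      using c d by blast
    show "(?G \<circ> ?F) x = (snd e \<circ> (g \<circ> f) \<circ> chart_inv c) x" if "x \<in> ?S" for x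
      using that M c(1) d(1) by auto
  qed
  then show ?thesis
    using frechet_derivative_compose[OF dF dG] unfolding Fp by argo
qed

lemma chart_coords_base:
  assumes "smooth_manifold M" "p \<in> topspace (mtop M)"
  shows "chart_coords M (chart_at M p) p = id"
proof -
  let ?c = "chart_at M p"
  have c: "?c \<in> charts M" "p \<in> fst ?c"
    using chart_at_charts[OF assms] by auto
  have "frechet_derivative (\<lambda>x. x) (at (snd ?c p)) = frechet_derivative (snd ?c \<circ> chart_inv ?c) (at (snd ?c p))"
    by (rule frechet_derivative_transform_within_open[OF _ open_chart_range[OF assms(1) c(1)]])
      (use c assms in auto)
  then show ?thesis
    by (simp add: chart_coords_def id_def)
qed

lemma chart_coords_tangent_map:
  assumes M: "smooth_manifold M" "smooth_manifold N" and f: "smooth_map M N f"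
    and c: "c \<in> charts M" "p \<in> fst c" and d: "d \<in> charts N" "f p \<in> fst d"
  shows "chart_coords N d (f p) (tangent_map M N f p u) =
    frechet_derivative (snd d \<circ> f \<circ> chart_inv c) (at (snd c p)) (chart_coords M c p u)"
proof -
  have p: "p \<in> topspace (mtop M)"
    using c M chart_subset_topspace by blast
  then have fp: "f p \<in> topspace (mtop N)"
    using f continuous_map_image_subset_topspace unfolding smooth_map_def by blast
  note c0 = chart_at_charts[OF M(1) p] and d0 = chart_at_charts[OF M(2) fp]
  \<comment> \<open>The same derivative is factored in two ways, through id after f and through f
    after id: the first yields \<open>tangent_map\<close> followed by \<open>chart_coords\<close> on
    N, the second \<open>chart_coords\<close> on M followed by the derivative of f in the charts c
    and d.\<close>
  note frechet_local_rep_compose[OF M f smooth_map_id[OF M(2)] c0 d0, of d]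
  moreover note frechet_local_rep_compose[OF M(1) M(1) smooth_map_id[OF M(1)] f c0 c(1), of d]
  ultimately show ?thesis
    unfolding chart_coords_def tangent_map_def using c d by (simp add: fun_eq_iff)
qed

lemma linear_tangent_map:
  assumes "smooth_manifold M" "smooth_manifold N" "smooth_map M N f" "p \<in> topspace (mtop M)"
  shows "linear (tangent_map M N f p)"
proof -
  have "f p \<in> topspace (mtop N)"
    using assms continuous_map_image_subset_topspace unfolding smooth_map_def by blast
  then show ?thesis
    unfolding tangent_map_def
    by (intro linear_frechet_derivative differentiable_local_rep[OF assms(3)] chart_at_charts assms)
qed

lemma linear_chart_coords:
  assumes "smooth_manifold M" "c \<in> charts M" "p \<in> fst c"
  shows "linear (chart_coords M c p)"
proof -
  have "p \<in> topspace (mtop M)"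
    using assms chart_subset_topspace by blast
  then show ?thesis
    using differentiable_local_rep[OF smooth_map_id[OF assms(1)], of "chart_at M p" c p]
      chart_at_charts[OF assms(1)] assms unfolding chart_coords_def
    by (auto intro: linear_frechet_derivative)
qed

lemma tangent_map_compose:
  assumes M: "smooth_manifold M1" "smooth_manifold M2" "smooth_manifold M3"
    and f: "smooth_map M1 M2 f" and g: "smooth_map M2 M3 g" and p: "p \<in> topspace (mtop M1)"
  shows "tangent_map M1 M3 (g \<circ> f) p u = tangent_map M2 M3 g (f p) (tangent_map M1 M2 f p u)"
proof -
  have fp: "f p \<in> topspace (mtop M2)"
    using f p continuous_map_image_subset_topspace unfolding smooth_map_def by blast
  then have gfp: "g (f p) \<in> topspace (mtop M3)"
    using g continuous_map_image_subset_topspace unfolding smooth_map_def by blast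
  note c = chart_at_charts[OF M(1) p] and d = chart_at_charts[OF M(2) fp]
    and e = chart_at_charts[OF M(3) gfp]
  show ?thesis
    unfolding tangent_map_def using frechet_local_rep_compose[OF M(1,2) f g c d e] by simp
qed

lemma tangent_map_id:
  assumes "smooth_manifold M" "p \<in> topspace (mtop M)"
  shows "tangent_map M M id p u = u"
  using chart_coords_base[OF assms] unfolding tangent_map_def chart_coords_def by simp

text \<open>Group laws hold on the carrier only, so identities between translations are available on
  the space and not as equations of functions; openness of the chart range makes that
  enough.\<close>

lemma tangent_map_cong:
  assumes M: "smooth_manifold M" "smooth_manifold N" and f: "smooth_map M N f"
    and p: "p \<in> topspace (mtop M)" and eq: "\<And>q. q \<in> topspace (mtop M) \<Longrightarrow> f q = g q"
  shows "tangent_map M N f p = tangent_map M N g p"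
proof -
  have fp: "f p \<in> topspace (mtop N)"
    using f p continuous_map_image_subset_topspace unfolding smooth_map_def by blast
  note c = chart_at_charts[OF M(1) p] and d = chart_at_charts[OF M(2) fp]
  have "frechet_derivative (snd (chart_at N (f p)) \<circ> f \<circ> chart_inv (chart_at M p)) (at (snd (chart_at M p) p)) =
    frechet_derivative (snd (chart_at N (f p)) \<circ> g \<circ> chart_inv (chart_at M p)) (at (snd (chart_at M p) p))"
  proof (rule frechet_derivative_transform_within_open)
    show "open (snd (chart_at M p) ` fst (chart_at M p))"
      by (rule open_chart_range[OF M(1) c(1)])
    show "(snd (chart_at N (f p)) \<circ> f \<circ> chart_inv (chart_at M p)) x =
      (snd (chart_at N (f p)) \<circ> g \<circ> chart_inv (chart_at M p)) x"
      if "x \<in> snd (chart_at M p) ` fst (chart_at M p)" for x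
      using that M(1) c chart_subset_topspace[OF M(1) c(1)] by (auto simp: eq subset_iff)
  qed (use differentiable_local_rep[OF f c(1) d(1) c(2) d(2)] c in auto)
  then show ?thesis
    unfolding tangent_map_def by (simp add: eq[OF p])
qed

text \<open>Removes the three derivative terms of \<open>ext_deriv2\<close> when the fields are left
  invariant.\<close>

lemma dir_deriv_const:
  assumes M: "smooth_manifold M" and p: "p \<in> topspace (mtop M)"
    and f: "\<And>q. q \<in> topspace (mtop M) \<Longrightarrow> f q = k"
  shows "dir_deriv M X f p = 0"
proof -
  note c = chart_at_charts[OF M p]
  have "frechet_derivative (\<lambda>x. k) (at (snd (chart_at M p) p)) =
    frechet_derivative (f \<circ> chart_inv (chart_at M p)) (at (snd (chart_at M p) p))"
    by (rule frechet_derivative_transform_within_open[OF _ open_chart_range[OF M c(1)]])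
      (use c M f chart_subset_topspace[OF M c(1)] in \<open>auto simp: subset_iff\<close>)
  then show ?thesis
    unfolding dir_deriv_def by (metis frechet_derivative_const)
qed

section \<open>Left invariant vector fields\<close>

context
  fixes G :: "('a, 'm) monoid_scheme" and M :: "('a, 'e::euclidean_space) manifold"
  assumes lie: "lie_group G M"
begin

interpretation group G
  using lie by (simp add: lie_group_def)

lemma lie_smooth_manifold: "smooth_manifold M"
  and lie_topspace: "topspace (mtop M) = carrier G"
  and lie_smooth_mult: "smooth_map (prod_manifold M M) M (\<lambda>(g, h). g \<otimes>\<^bsub>G\<^esub> h)"
  and lie_smooth_inv: "smooth_map M M (\<lambda>g. inv\<^bsub>G\<^esub> g)"
  using lie by (auto simp: lie_group_def)

lemma lie_chart_subset: "c \<in> charts M \<Longrightarrow> fst c \<subseteq> carrier G"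
  using chart_subset_topspace[OF lie_smooth_manifold] lie_topspace by simp

lemma lie_chart_at: "g \<in> carrier G \<Longrightarrow> chart_at M g \<in> charts M" "g \<in> carrier G \<Longrightarrow> g \<in> fst (chart_at M g)"
  using chart_at_charts[OF lie_smooth_manifold] lie_topspace by auto

text \<open>Multiplication read in charts as a single map of both coordinates, so that one smooth
  function governs the translations by all g in the domain of e at once.\<close>

definition mult_rep :: "('a, 'e) chart \<Rightarrow> ('a, 'e) chart \<Rightarrow> ('a, 'e) chart \<Rightarrow> 'e \<times> 'e \<Rightarrow> 'e" where
  "mult_rep e c d = (\<lambda>(z, x). snd d (chart_inv e z \<otimes>\<^bsub>G\<^esub> chart_inv c x))"

definition mult_dom :: "('a, 'e) chart \<Rightarrow> ('a, 'e) chart \<Rightarrow> ('a, 'e) chart \<Rightarrow> ('e \<times> 'e) set" where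
  "mult_dom e c d = (\<lambda>(g, h). (snd e g, snd c h)) ` {(g, h). g \<in> fst e \<and> h \<in> fst c \<and> g \<otimes>\<^bsub>G\<^esub> h \<in> fst d}"

lemma mult_domI:
  "g \<in> fst e \<Longrightarrow> h \<in> fst c \<Longrightarrow> g \<otimes>\<^bsub>G\<^esub> h \<in> fst d \<Longrightarrow> (snd e g, snd c h) \<in> mult_dom e c d"
  unfolding mult_dom_def by force

lemma open_mult_dom:
  assumes e: "e \<in> charts M" and c: "c \<in> charts M" and d: "d \<in> charts M"
  shows "open (mult_dom e c d)"
proof (rule Topological_Spaces.openI)
  note sm = lie_smooth_manifold
  fix w assume "w \<in> mult_dom e c d"
  then obtain g h where gh: "g \<in> fst e" "h \<in> fst c" "g \<otimes>\<^bsub>G\<^esub> h \<in> fst d" "w = (snd e g, snd c h)"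
    unfolding mult_dom_def by auto
  let ?P = "{p \<in> topspace (prod_topology (mtop M) (mtop M)). (\<lambda>(g, h). g \<otimes>\<^bsub>G\<^esub> h) p \<in> fst d}"
  have "openin (prod_topology (mtop M) (mtop M)) ?P"
    using lie_smooth_mult chart_openin[OF sm d] openin_continuous_map_preimage
    unfolding smooth_map_def prod_manifold_def by fastforce
  moreover have "(g, h) \<in> ?P"
    using gh chart_subset_topspace[OF sm e] chart_subset_topspace[OF sm c] by auto
  ultimately obtain U V where UV: "openin (mtop M) U" "openin (mtop M) V" "g \<in> U" "h \<in> V" "U \<times> V \<subseteq> ?P"
    unfolding openin_prod_topology_alt by meson
  \<comment> \<open>A box inside the preimage of the domain of d, cut down to the two chart domains,
    so that its image is a product of open sets.\<close>
  let ?T = "(snd e ` (U \<inter> fst e)) \<times> (snd c ` (V \<inter> fst c))"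
  have "open (snd e ` (U \<inter> fst e))" "open (snd c ` (V \<inter> fst c))"
    by (intro open_chart_image[OF sm] e c openin_Int UV chart_openin[OF sm] Int_lower2)+
  then have "open ?T"
    by (rule open_Times)
  moreover have "w \<in> ?T"
    using gh UV by auto
  moreover have "?T \<subseteq> mult_dom e c d"
    using UV(5) by (auto intro!: mult_domI)
  ultimately show "\<exists>T. open T \<and> w \<in> T \<and> T \<subseteq> mult_dom e c d"
    by blast
qed

lemma smooth_mult_rep:
  assumes e: "e \<in> charts M" and c: "c \<in> charts M" and d: "d \<in> charts M"
  shows "smooth_on (mult_dom e c d) (mult_rep e c d)"
proof -
  note sm = lie_smooth_manifold
  let ?C = "(fst e \<times> fst c, map_prod (snd e) (snd c))"
  have C: "?C \<in> charts (prod_manifold M M)"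
    unfolding prod_manifold_def manifold.simps using e c by blast
  have dom: "snd ?C ` {p \<in> fst ?C. (case p of (g, h) \<Rightarrow> g \<otimes>\<^bsub>G\<^esub> h) \<in> fst d} = mult_dom e c d"
    unfolding mult_dom_def by (auto simp: image_iff)
  have inj: "inj_on (map_prod (snd e) (snd c)) (fst e \<times> fst c)"
    using chart_inj_on[OF sm e] chart_inj_on[OF sm c] by (rule map_prod_inj_on)
  have "(snd d \<circ> (\<lambda>(g, h). g \<otimes>\<^bsub>G\<^esub> h) \<circ> chart_inv ?C) x = mult_rep e c d x" if x: "x \<in> mult_dom e c d" for x
  proof -
    obtain g h where gh: "g \<in> fst e" "h \<in> fst c" "x = (snd e g, snd c h)"
      using x unfolding mult_dom_def by auto
    have "chart_inv ?C x = (g, h)"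
      unfolding chart_inv_def using gh inv_into_f_f[OF inj, of "(g, h)"] by simp
    then show ?thesis
      using gh e c sm by (simp add: mult_rep_def)
  qed
  moreover have "smooth_on (mult_dom e c d) (snd d \<circ> (\<lambda>(g, h). g \<otimes>\<^bsub>G\<^esub> h) \<circ> chart_inv ?C)"
    using smooth_local_rep[OF lie_smooth_mult C d] unfolding dom .
  ultimately show ?thesis
    using smooth_on_cong[OF open_mult_dom[OF e c d]] by blast
qed

lemma smooth_left_translation:
  assumes g: "g \<in> carrier G"
  shows "smooth_map M M (\<lambda>h. g \<otimes>\<^bsub>G\<^esub> h)"
  unfolding smooth_map_def
proof (intro conjI ballI)
  note sm = lie_smooth_manifold
  have "continuous_map (mtop M) (prod_topology (mtop M) (mtop M)) (\<lambda>h. (g, h))"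
    using g lie_topspace by (simp add: continuous_map_pairedI)
  then have "continuous_map (mtop M) (mtop M) ((\<lambda>(g, h). g \<otimes>\<^bsub>G\<^esub> h) \<circ> (\<lambda>h. (g, h)))"
    using lie_smooth_mult unfolding smooth_map_def prod_manifold_def
    by (intro continuous_map_compose) auto
  then show cont: "continuous_map (mtop M) (mtop M) (\<lambda>h. g \<otimes>\<^bsub>G\<^esub> h)"
    by (simp add: o_def)
  fix c d assume c: "c \<in> charts M" and d: "d \<in> charts M"
  let ?e = "chart_at M g" and ?S = "snd c ` {p \<in> fst c. g \<otimes>\<^bsub>G\<^esub> p \<in> fst d}"
  note e = lie_chart_at[OF g]
  have "openin (mtop M) {p \<in> topspace (mtop M). g \<otimes>\<^bsub>G\<^esub> p \<in> fst d}"
    using cont chart_openin[OF sm d] by (rule openin_continuous_map_preimage)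
  then have "openin (mtop M) (fst c \<inter> {p \<in> topspace (mtop M). g \<otimes>\<^bsub>G\<^esub> p \<in> fst d})"
    using chart_openin[OF sm c] by blast
  also have "fst c \<inter> {p \<in> topspace (mtop M). g \<otimes>\<^bsub>G\<^esub> p \<in> fst d} = {p \<in> fst c. g \<otimes>\<^bsub>G\<^esub> p \<in> fst d}"
    using chart_subset_topspace[OF sm c] by blast
  finally have S: "open ?S"
    by (intro open_chart_image[OF sm c]) auto
  \<comment> \<open>In the chart at g, translation by g freezes the first slot of
    \<open>mult_rep\<close> at the coordinates of g.\<close>
  have "smooth_on ?S (\<lambda>x. mult_rep ?e c d (snd ?e g, x))"
    by (rule smooth_on_compose[OF S _ smooth_mult_rep[OF e(1) c d]])
      (use e S in \<open>auto intro!: smooth_on_Pair smooth_on_const smooth_on_ident mult_domI\<close>)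
  then show "smooth_on ?S (snd d \<circ> (\<lambda>h. g \<otimes>\<^bsub>G\<^esub> h) \<circ> chart_inv c)"
    by (rule smooth_on_cong[OF S]) (use sm e in \<open>simp add: mult_rep_def\<close>)
qed

section \<open>Differentials of left translations\<close>

lemma linear_dL: "g \<in> carrier G \<Longrightarrow> h \<in> carrier G \<Longrightarrow> linear (dL G M g h)"
  unfolding dL_def
  using linear_tangent_map[OF lie_smooth_manifold lie_smooth_manifold smooth_left_translation] lie_topspace by blast

lemma dL_mult:
  assumes "g \<in> carrier G" "h \<in> carrier G" "k \<in> carrier G"
  shows "dL G M (g \<otimes>\<^bsub>G\<^esub> h) k u = dL G M g (h \<otimes>\<^bsub>G\<^esub> k) (dL G M h k u)"
proof -
  note sm = lie_smooth_manifold
  have "tangent_map M M (\<lambda>q. g \<otimes>\<^bsub>G\<^esub> h \<otimes>\<^bsub>G\<^esub> q) k =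
      tangent_map M M ((\<lambda>q. g \<otimes>\<^bsub>G\<^esub> q) \<circ> (\<lambda>q. h \<otimes>\<^bsub>G\<^esub> q)) k"
    by (rule tangent_map_cong[OF sm sm smooth_left_translation])
      (use assms lie_topspace in \<open>auto simp: m_assoc\<close>)
  then show ?thesis
    unfolding dL_def
    using tangent_map_compose[OF sm sm sm smooth_left_translation[OF assms(2)] smooth_left_translation[OF assms(1)]]
      assms(3) lie_topspace by simp
qed

lemma dL_one:
  assumes "g \<in> carrier G"
  shows "dL G M \<one>\<^bsub>G\<^esub> g u = u"
proof -
  note sm = lie_smooth_manifold
  have "tangent_map M M id g = tangent_map M M (\<lambda>q. \<one>\<^bsub>G\<^esub> \<otimes>\<^bsub>G\<^esub> q) g"
    by (rule tangent_map_cong[OF sm sm smooth_map_id[OF sm]]) (use assms lie_topspace in auto)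
  then show ?thesis
    unfolding dL_def using tangent_map_id[OF sm] assms lie_topspace by metis
qed

lemma dL_inv_dL:
  assumes "g \<in> carrier G"
  shows "dL G M (inv\<^bsub>G\<^esub> g) g (dL G M g \<one>\<^bsub>G\<^esub> u) = u"
    and "dL G M g \<one>\<^bsub>G\<^esub> (dL G M (inv\<^bsub>G\<^esub> g) g u) = u"
  using dL_mult[of "inv\<^bsub>G\<^esub> g" g "\<one>\<^bsub>G\<^esub>" u] dL_mult[of g "inv\<^bsub>G\<^esub> g" g u] assms
  by (simp_all add: dL_one)

lemma left_vf_one: "left_vf G M u \<one>\<^bsub>G\<^esub> = u"
  by (simp add: left_vf_def dL_one)

abbreviation unit_chart :: "('a, 'e) chart" where
  "unit_chart \<equiv> chart_at M \<one>\<^bsub>G\<^esub>"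

lemma chart_coords_unit: "chart_coords M unit_chart \<one>\<^bsub>G\<^esub> u = u"
  using chart_coords_base[OF lie_smooth_manifold] lie_topspace by simp

text \<open>The frame E of left invariant fields in the chart c. The vector of the Lie algebra comes
  last, so that \<open>left_rep c x\<close> is a linear map depending on x.\<close>

definition left_rep :: "('a, 'e) chart \<Rightarrow> 'e \<Rightarrow> 'e \<Rightarrow> 'e" where
  "left_rep c x u = vf_rep M c (left_vf G M u) x"

lemma left_rep_chart:
  assumes c: "c \<in> charts M" "p \<in> fst c"
  shows "left_rep c (snd c p) u = chart_coords M c p (dL G M p \<one>\<^bsub>G\<^esub> u)"
  using assms lie_smooth_manifold by (simp add: left_rep_def vf_rep_chart_coords left_vf_def)

lemma linear_left_rep:
  assumes c: "c \<in> charts M" and x: "x \<in> snd c ` fst c"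
  shows "linear (left_rep c x)"
proof -
  obtain p where p: "p \<in> fst c" "x = snd c p"
    using x by blast
  have "linear (chart_coords M c p \<circ> dL G M p \<one>\<^bsub>G\<^esub>)"
    using linear_compose[OF linear_dL linear_chart_coords[OF lie_smooth_manifold c]] lie_chart_subset[OF c] p
    by auto
  moreover have "left_rep c x = chart_coords M c p \<circ> dL G M p \<one>\<^bsub>G\<^esub>"
    by (rule ext) (simp add: p(2) left_rep_chart[OF c p(1)])
  ultimately show ?thesis
    by simp
qed

lemma frechet_left_translation_rep:
  assumes e: "e \<in> charts M" "g \<in> fst e" and c: "c \<in> charts M" "h \<in> fst c"
    and d: "d \<in> charts M" "g \<otimes>\<^bsub>G\<^esub> h \<in> fst d"
  shows "frechet_derivative (snd d \<circ> (\<lambda>k. g \<otimes>\<^bsub>G\<^esub> k) \<circ> chart_inv c) (at (snd c h)) v =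
    frechet_derivative (mult_rep e c d) (at (snd e g, snd c h)) (0, v)"
proof -
  have "snd d \<circ> (\<lambda>k. g \<otimes>\<^bsub>G\<^esub> k) \<circ> chart_inv c = (\<lambda>y. mult_rep e c d (snd e g, y))"
    using e lie_smooth_manifold by (auto simp: mult_rep_def)
  moreover have "mult_rep e c d differentiable (at (snd e g, snd c h))"
    by (rule smooth_on_differentiable[OF smooth_mult_rep[OF e(1) c(1) d(1)]]) (use e c d in \<open>auto intro: mult_domI\<close>)
  ultimately show ?thesis
    using frechet_derivative_snd_arg by simp
qed

lemma left_rep_eq:
  assumes c: "c \<in> charts M" and x: "x \<in> snd c ` fst c"
  shows "left_rep c x u = frechet_derivative (mult_rep c unit_chart c) (at (x, snd unit_chart \<one>\<^bsub>G\<^esub>)) (0, u)"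
proof -
  note sm = lie_smooth_manifold
  obtain p where p: "p \<in> fst c" "x = snd c p"
    using x by blast
  have pG: "p \<in> carrier G"
    using p lie_chart_subset[OF c] by blast
  \<comment> \<open>Reading p as p times the unit makes c the target chart and
    \<open>unit_chart\<close> the source chart, in which tangent vectors at the unit are already
    expressed.\<close>
  have "left_rep c x u = chart_coords M c (p \<otimes>\<^bsub>G\<^esub> \<one>\<^bsub>G\<^esub>) (tangent_map M M (\<lambda>k. p \<otimes>\<^bsub>G\<^esub> k) \<one>\<^bsub>G\<^esub> u)"
    using left_rep_chart[OF c p(1)] p pG by (simp add: dL_def)
  also have "\<dots> = frechet_derivative (snd c \<circ> (\<lambda>k. p \<otimes>\<^bsub>G\<^esub> k) \<circ> chart_inv unit_chart) (at (snd unit_chart \<one>\<^bsub>G\<^esub>)) u"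
    using chart_coords_tangent_map[OF sm sm smooth_left_translation[OF pG], of unit_chart "\<one>\<^bsub>G\<^esub>" c u]
      c p pG lie_chart_at[OF one_closed] chart_coords_unit by simp
  also have "\<dots> = frechet_derivative (mult_rep c unit_chart c) (at (x, snd unit_chart \<one>\<^bsub>G\<^esub>)) (0, u)"
    using frechet_left_translation_rep[OF c p(1) lie_chart_at[OF one_closed] c] p pG by simp
  finally show ?thesis .
qed

lemma smooth_left_rep:
  assumes c: "c \<in> charts M"
  shows "smooth_on (snd c ` fst c) (\<lambda>x. left_rep c x u)"
proof -
  let ?S = "snd c ` fst c"
  have S: "open ?S"
    by (rule open_chart_range[OF lie_smooth_manifold c])
  have "smooth_on ?S (\<lambda>x. frechet_derivative (mult_rep c unit_chart c) (at (x, snd unit_chart \<one>\<^bsub>G\<^esub>)) (0, u))"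
  proof (rule smooth_on_compose[OF S, where f = "\<lambda>x. (x, snd unit_chart \<one>\<^bsub>G\<^esub>)"
      and g = "\<lambda>w. frechet_derivative (mult_rep c unit_chart c) (at w) (0, u)"])
    show "smooth_on (mult_dom c unit_chart c) (\<lambda>w. frechet_derivative (mult_rep c unit_chart c) (at w) (0, u))"
      by (intro smooth_on_frechet_derivative smooth_mult_rep c lie_chart_at one_closed)
    show "smooth_on ?S (\<lambda>x. (x, snd unit_chart \<one>\<^bsub>G\<^esub>))"
      by (intro smooth_on_Pair smooth_on_const smooth_on_ident S)
    show "(\<lambda>x. (x, snd unit_chart \<one>\<^bsub>G\<^esub>)) ` ?S \<subseteq> mult_dom c unit_chart c"
      using lie_chart_subset[OF c] lie_chart_at[OF one_closed] by (auto intro!: mult_domI simp: subset_iff)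
  qed
  then show ?thesis
    by (rule smooth_on_cong[OF S]) (simp add: left_rep_eq[OF c])
qed

lemma smooth_left_vf: "smooth_vf M (left_vf G M u)"
  unfolding smooth_vf_def using smooth_left_rep unfolding left_rep_def by blast

text \<open>The inverse of the frame of left invariant fields, in a chart: translation back to the unit.\<close>

definition coframe_rep :: "('a, 'e) chart \<Rightarrow> 'e \<Rightarrow> 'e \<Rightarrow> 'e" where
  "coframe_rep c x v = frechet_derivative
    (snd unit_chart \<circ> (\<lambda>k. inv\<^bsub>G\<^esub> chart_inv c x \<otimes>\<^bsub>G\<^esub> k) \<circ> chart_inv c) (at x) v"

lemma coframe_rep_chart_coords:
  assumes c: "c \<in> charts M" "p \<in> fst c"
  shows "coframe_rep c (snd c p) (chart_coords M c p u) = dL G M (inv\<^bsub>G\<^esub> p) p u"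
proof -
  note sm = lie_smooth_manifold
  have p: "p \<in> carrier G"
    using c lie_chart_subset by blast
  \<comment> \<open>The translated vector sits at the unit, where \<open>unit_chart\<close> is the
    preferred chart, so the outer \<open>chart_coords\<close> is the identity.\<close>
  have "chart_coords M unit_chart (inv\<^bsub>G\<^esub> p \<otimes>\<^bsub>G\<^esub> p) (tangent_map M M (\<lambda>k. inv\<^bsub>G\<^esub> p \<otimes>\<^bsub>G\<^esub> k) p u) =
      coframe_rep c (snd c p) (chart_coords M c p u)"
    using chart_coords_tangent_map[OF sm sm smooth_left_translation c, of "inv\<^bsub>G\<^esub> p" unit_chart u]
      p c sm lie_chart_at[OF one_closed] by (simp add: coframe_rep_def)
  then show ?thesis
    using p chart_coords_unit by (simp add: dL_def)
qed

lemma linear_coframe_rep: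
  assumes c: "c \<in> charts M" and x: "x \<in> snd c ` fst c"
  shows "linear (coframe_rep c x)"
proof -
  note sm = lie_smooth_manifold
  obtain p where p: "p \<in> fst c" "x = snd c p"
    using x by blast
  have pG: "p \<in> carrier G"
    using p lie_chart_subset[OF c] by blast
  have "(snd unit_chart \<circ> (\<lambda>k. inv\<^bsub>G\<^esub> p \<otimes>\<^bsub>G\<^esub> k) \<circ> chart_inv c) differentiable (at (snd c p))"
    by (rule differentiable_local_rep[OF smooth_left_translation])
      (use c p pG lie_chart_at[OF one_closed] in auto)
  then show ?thesis
    unfolding coframe_rep_def using p c sm by (auto intro!: linear_frechet_derivative)
qed

lemma smooth_coframe_rep:
  assumes c: "c \<in> charts M"
  shows "smooth_on (snd c ` fst c) (\<lambda>x. coframe_rep c x v)"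
proof (rule smooth_on_local)
  note sm = lie_smooth_manifold and u1 = lie_chart_at[OF one_closed]
  fix x assume "x \<in> snd c ` fst c"
  then obtain p where p: "p \<in> fst c" "x = snd c p"
    by blast
  have pG: "p \<in> carrier G"
    using p lie_chart_subset[OF c] by blast
  \<comment> \<open>The inverses of the points of c need not lie in a single chart, so smoothness is
    shown near each p, with a chart around the inverse of p.\<close>
  let ?d = "chart_at M (inv\<^bsub>G\<^esub> p)"
  note d = lie_chart_at[OF inv_closed[OF pG]]
  let ?U = "{q \<in> fst c. inv\<^bsub>G\<^esub> q \<in> fst ?d}"
  let ?F = "mult_rep ?d c unit_chart"
  let ?I = "snd ?d \<circ> (\<lambda>g. inv\<^bsub>G\<^esub> g) \<circ> chart_inv c"
  have U: "open (snd c ` ?U)"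
    by (rule open_local_domain[OF sm sm lie_smooth_inv c d(1)])
  \<comment> \<open>The derivative of multiplication is taken at (\<open>?I x\<close>, x), with
    \<open>?I\<close> the inversion in charts: here smoothness of inversion enters.\<close>
  have "smooth_on (snd c ` ?U) (\<lambda>x. frechet_derivative ?F (at (?I x, x)) (0, v))"
  proof (rule smooth_on_compose[OF U, where f = "\<lambda>x. (?I x, x)"
      and g = "\<lambda>w. frechet_derivative ?F (at w) (0, v)"])
    show "smooth_on (mult_dom ?d c unit_chart) (\<lambda>w. frechet_derivative ?F (at w) (0, v))"
      by (intro smooth_on_frechet_derivative smooth_mult_rep c d u1)
    show "smooth_on (snd c ` ?U) (\<lambda>x. (?I x, x))"
      by (intro smooth_on_Pair smooth_on_ident U smooth_local_rep[OF lie_smooth_inv c d(1)])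
    show "(\<lambda>x. (?I x, x)) ` (snd c ` ?U) \<subseteq> mult_dom ?d c unit_chart"
      using lie_chart_subset[OF c] u1 sm c by (auto intro!: mult_domI simp: subset_iff)
  qed
  then have "smooth_on (snd c ` ?U) (\<lambda>x. coframe_rep c x v)"
  proof (rule smooth_on_cong[OF U])
    fix x assume "x \<in> snd c ` ?U"
    then obtain q where q: "q \<in> fst c" "inv\<^bsub>G\<^esub> q \<in> fst ?d" "x = snd c q"
      by blast
    then have "inv\<^bsub>G\<^esub> q \<otimes>\<^bsub>G\<^esub> q \<in> fst unit_chart"
      using lie_chart_subset[OF c] u1 by (auto simp: subset_iff)
    from frechet_left_translation_rep[OF d(1) q(2) c q(1) u1(1) this]
    show "frechet_derivative ?F (at (?I x, x)) (0, v) = coframe_rep c x v"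
      using q sm c by (simp add: coframe_rep_def)
  qed
  moreover have "x \<in> snd c ` ?U"
    using p d by blast
  ultimately show "\<exists>T. open T \<and> x \<in> T \<and> smooth_on T (\<lambda>x. coframe_rep c x v)"
    using U by blast
qed

lemma vf_bracket_left_vf:
  assumes p: "p \<in> carrier G"
  shows "vf_bracket M (left_vf G M u) (left_vf G M v) p = dL G M p \<one>\<^bsub>G\<^esub> (lie_algebra_bracket G M u v)"
proof -
  note sm = lie_smooth_manifold and u1 = lie_chart_at[OF one_closed] and c = lie_chart_at[OF p]
  let ?c = "chart_at M p" and ?e = "snd unit_chart \<one>\<^bsub>G\<^esub>"
  let ?f = "\<lambda>k. p \<otimes>\<^bsub>G\<^esub> k"
  let ?L = "snd ?c \<circ> ?f \<circ> chart_inv unit_chart"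
  let ?D = "\<lambda>y. frechet_derivative ?L (at y)"
  let ?T = "snd unit_chart ` {q \<in> fst unit_chart. ?f q \<in> fst ?c}"
  note f = smooth_left_translation[OF p]
  have T: "open ?T" "?e \<in> ?T"
    using open_local_domain[OF sm sm f u1(1) c(1)] u1 c p by auto
  have L: "smooth_on ?T ?L"
    by (rule smooth_local_rep[OF f u1(1) c(1)])
  have Le: "?L ?e = snd ?c p"
    using u1 sm p by simp
  \<comment> \<open>Left invariance in coordinates: the differential of the translation carries the
    frame at y to the frame at \<open>?L y\<close>.\<close>
  have rel: "left_rep ?c (?L y) w = ?D y (left_rep unit_chart y w)" if "y \<in> ?T" for y w
  proof -
    obtain q where q: "q \<in> fst unit_chart" "?f q \<in> fst ?c" "y = snd unit_chart q"
      using \<open>y \<in> ?T\<close> by blast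
    have qG: "q \<in> carrier G"
      using q lie_chart_subset[OF u1(1)] by blast
    have "left_rep ?c (?L y) w = chart_coords M ?c (?f q) (dL G M p q (dL G M q \<one>\<^bsub>G\<^esub> w))"
      using q c u1 sm p qG left_rep_chart[OF c(1) q(2)] dL_mult[of p q "\<one>\<^bsub>G\<^esub>" w] by simp
    also have "\<dots> = ?D y (chart_coords M unit_chart q (dL G M q \<one>\<^bsub>G\<^esub> w))"
      unfolding dL_def[of G M p] q(3) by (rule chart_coords_tangent_map[OF sm sm f u1(1) q(1) c(1) q(2)])
    also have "\<dots> = ?D y (left_rep unit_chart y w)"
      using left_rep_chart[OF u1(1) q(1)] q by simp
    finally show ?thesis .
  qed
  have u1rep: "left_rep unit_chart ?e w = w" for w
    using left_rep_chart[OF u1] chart_coords_unit by (simp add: dL_one)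
  have dc: "(\<lambda>x. left_rep ?c x w) differentiable (at (?L ?e))" for w
    unfolding Le by (rule smooth_on_differentiable[OF smooth_left_rep[OF c(1)]]) (use c in blast)
  have d1: "(\<lambda>x. left_rep unit_chart x w) differentiable (at ?e)" for w
    by (rule smooth_on_differentiable[OF smooth_left_rep[OF u1(1)]]) (use u1 in blast)
  have dL: "?L differentiable (at y)" if "y \<in> ?T" for y
    using smooth_on_differentiable[OF L that] .
  \<comment> \<open>Both sides of \<open>rel\<close> are differentiated at the unit in direction h,
    the left one by the chain rule, the right one by the product rule; at the unit the frame is the
    identity.\<close>
  have key: "frechet_derivative (\<lambda>x. left_rep ?c x w) (at (snd ?c p)) (?D ?e h) =
      frechet_derivative (\<lambda>y. ?D y w) (at ?e) h +
      ?D ?e (frechet_derivative (\<lambda>x. left_rep unit_chart x w) (at ?e) h)" for w h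
  proof -
    have "((\<lambda>y. ?D y (left_rep unit_chart y w)) has_derivative
        (\<lambda>h. frechet_derivative (\<lambda>y. ?D y w) (at ?e) h +
          ?D ?e (frechet_derivative (\<lambda>x. left_rep unit_chart x w) (at ?e) h))) (at ?e)"
      using has_derivative_linear_apply[OF T, of ?D "\<lambda>x. left_rep unit_chart x w"] d1 u1rep
        linear_frechet_derivative[OF dL] smooth_on_differentiable[OF smooth_on_frechet_derivative[OF L] T(2)]
      by simp
    then have "((\<lambda>y. left_rep ?c (?L y) w) has_derivative
        (\<lambda>h. frechet_derivative (\<lambda>y. ?D y w) (at ?e) h +
          ?D ?e (frechet_derivative (\<lambda>x. left_rep unit_chart x w) (at ?e) h))) (at ?e)"
      by (rule has_derivative_transform_within_open[OF _ T]) (simp only: rel)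
    moreover have "((\<lambda>y. left_rep ?c (?L y) w) has_derivative
        (\<lambda>h. frechet_derivative (\<lambda>x. left_rep ?c x w) (at (?L ?e)) (?D ?e h))) (at ?e)"
      using diff_chain_at[OF frechet_derivative_works[THEN iffD1, OF dL[OF T(2)]]
        frechet_derivative_works[THEN iffD1, OF dc[of w]]] unfolding o_def .
    ultimately show ?thesis
      unfolding Le[symmetric] by (rule fun_cong[OF has_derivative_unique, rotated])
  qed
  have left: "left_vf G M w p = ?D ?e w" for w
    using p by (simp add: left_vf_def dL_def tangent_map_def)
  have lin: "?D ?e (x - y) = ?D ?e x - ?D ?e y" for x y
    using linear_diff[OF linear_frechet_derivative[OF dL[OF T(2)]]] .
  have "vf_bracket M (left_vf G M u) (left_vf G M v) p =
      frechet_derivative (\<lambda>x. left_rep ?c x v) (at (snd ?c p)) (?D ?e u) -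
      frechet_derivative (\<lambda>x. left_rep ?c x u) (at (snd ?c p)) (?D ?e v)"
    unfolding vf_bracket_def Let_def left_rep_def left ..
  also have "\<dots> = ?D ?e (frechet_derivative (\<lambda>x. left_rep unit_chart x v) (at ?e) u -
      frechet_derivative (\<lambda>x. left_rep unit_chart x u) (at ?e) v)"
    \<comment> \<open>The two instances of \<open>key\<close> contribute second derivatives of
      \<open>?L\<close> with u and v exchanged, which cancel in the difference.\<close>
    using symmetric_second_derivative[OF T L, of u v] by (simp add: key lin)
  also have "\<dots> = ?D ?e (lie_algebra_bracket G M u v)"
    unfolding lie_algebra_bracket_def vf_bracket_def Let_def left_vf_one left_rep_def ..
  finally show ?thesis
    using left unfolding left_vf_def by simp
qed

end

section \<open>Left invariant complex structures\<close>

context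
  fixes G :: "('a, 'm) monoid_scheme" and M :: "('a, 'e::euclidean_space) manifold"
  assumes lie: "lie_group G M"
begin

interpretation group G
  using lie by (simp add: lie_group_def)

lemma linear_lie_algebra_bracket: "linear (lie_algebra_bracket G M u)"
proof -
  note c = lie_chart_at[OF lie one_closed] and sm = lie_smooth_manifold[OF lie]
  let ?c = "chart_at M \<one>\<^bsub>G\<^esub>"
  let ?e = "snd ?c \<one>\<^bsub>G\<^esub>" and ?S = "snd ?c ` fst ?c"
  have S: "open ?S" "?e \<in> ?S"
    using open_chart_range[OF sm c(1)] c by auto
  have d: "(\<lambda>x. left_rep G M ?c x v) differentiable (at ?e)" for v
    by (rule smooth_on_differentiable[OF smooth_left_rep[OF lie c(1)] S(2)])
  have "linear (\<lambda>v. frechet_derivative (\<lambda>x. left_rep G M ?c x v) (at ?e) u -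
      frechet_derivative (\<lambda>x. left_rep G M ?c x u) (at ?e) v)"
    by (intro linear_compose_sub linear_frechet_derivative_family[OF S] linear_left_rep[OF lie c(1)]
        linear_frechet_derivative d)
  then show ?thesis
    unfolding lie_algebra_bracket_def vf_bracket_def Let_def left_vf_one[OF lie] left_rep_def[OF lie] .
qed

lemma lie_algebra_bracket_antisym: "lie_algebra_bracket G M u v = - lie_algebra_bracket G M v u"
  by (simp add: lie_algebra_bracket_def vf_bracket_def Let_def)

text \<open>The coefficient function of X in the left invariant frame, in the coordinates of c.
  Going through \<open>coframe_rep\<close> presents it as a smooth family of linear maps applied to
  a smooth function.\<close>

definition frame_comp :: "('a, 'e) chart \<Rightarrow> ('a \<Rightarrow> 'e) \<Rightarrow> 'e \<Rightarrow> 'e" where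
  "frame_comp c X x = coframe_rep G M c x (vf_rep M c X x)"

lemma frame_comp_chart:
  assumes "c \<in> charts M" "p \<in> fst c"
  shows "frame_comp c X (snd c p) = dL G M (inv\<^bsub>G\<^esub> p) p (X p)"
  using coframe_rep_chart_coords[OF lie assms] lie_smooth_manifold[OF lie] assms
  by (simp add: frame_comp_def vf_rep_chart_coords)

lemma left_rep_frame_comp:
  assumes c: "c \<in> charts M" and x: "x \<in> snd c ` fst c"
  shows "left_rep G M c x (frame_comp c X x) = vf_rep M c X x"
proof -
  obtain p where p: "p \<in> fst c" "x = snd c p"
    using x by blast
  then show ?thesis
    using left_rep_chart[OF lie c p(1)] frame_comp_chart[OF c p(1)] dL_inv_dL(2)[OF lie]
      lie_chart_subset[OF lie c] lie_smooth_manifold[OF lie] c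
    by (auto simp: vf_rep_chart_coords)
qed

lemma smooth_frame_comp:
  assumes c: "c \<in> charts M" and X: "smooth_vf M X"
  shows "smooth_on (snd c ` fst c) (frame_comp c X)"
  unfolding frame_comp_def
  by (rule smooth_on_linear_apply[OF open_chart_range[OF lie_smooth_manifold[OF lie] c]
        linear_coframe_rep[OF lie c] smooth_coframe_rep[OF lie c]])
    (use X c in \<open>auto simp: smooth_vf_def\<close>)

text \<open>By the product rule, the terms in which the frame is differentiated see the coefficients
  only through their values at p. They therefore add up to the bracket of the left invariant fields
  with these values; the remaining terms differentiate the coefficients.\<close>

lemma vf_bracket_frame_comp:
  assumes X: "smooth_vf M X" and Y: "smooth_vf M Y" and p: "p \<in> carrier G"
  defines "c \<equiv> chart_at M p"
  shows "vf_bracket M X Y p = dL G M p \<one>\<^bsub>G\<^esub>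
    (lie_algebra_bracket G M (dL G M (inv\<^bsub>G\<^esub> p) p (X p)) (dL G M (inv\<^bsub>G\<^esub> p) p (Y p))
      + frechet_derivative (frame_comp c Y) (at (snd c p)) (X p)
      - frechet_derivative (frame_comp c X) (at (snd c p)) (Y p))"
proof -
  note sm = lie_smooth_manifold[OF lie]
  note c = lie_chart_at[OF lie p, folded c_def]
  let ?x = "snd c p" and ?S = "snd c ` fst c"
  have S: "open ?S" "?x \<in> ?S"
    using open_chart_range[OF sm c(1)] c by auto
  have at_p: "chart_coords M c p u = u" for u
    unfolding c_def using chart_coords_base[OF sm] p lie_topspace[OF lie] by simp
  have left: "left_rep G M c ?x u = dL G M p \<one>\<^bsub>G\<^esub> u" for u
    using left_rep_chart[OF lie c] at_p by simp
  have der: "frechet_derivative (vf_rep M c Z) (at ?x) h =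
      frechet_derivative (\<lambda>x. left_rep G M c x (dL G M (inv\<^bsub>G\<^esub> p) p (Z p))) (at ?x) h +
      dL G M p \<one>\<^bsub>G\<^esub> (frechet_derivative (frame_comp c Z) (at ?x) h)" if Z: "smooth_vf M Z" for Z h
  proof -
    have "((\<lambda>x. left_rep G M c x (frame_comp c Z x)) has_derivative
      (\<lambda>h. frechet_derivative (\<lambda>x. left_rep G M c x (frame_comp c Z ?x)) (at ?x) h +
        left_rep G M c ?x (frechet_derivative (frame_comp c Z) (at ?x) h))) (at ?x)"
      by (rule has_derivative_linear_apply[OF S linear_left_rep[OF lie c(1)]])
        (use smooth_on_differentiable[OF smooth_left_rep[OF lie c(1)] S(2)]
          smooth_on_differentiable[OF smooth_frame_comp[OF c(1) Z] S(2)] in auto)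
    then have "(vf_rep M c Z has_derivative
      (\<lambda>h. frechet_derivative (\<lambda>x. left_rep G M c x (frame_comp c Z ?x)) (at ?x) h +
        left_rep G M c ?x (frechet_derivative (frame_comp c Z) (at ?x) h))) (at ?x)"
      by (rule has_derivative_transform_within_open[OF _ S]) (rule left_rep_frame_comp[OF c(1)])
    from fun_cong[OF frechet_derivative_at[OF this, symmetric], of h]
    show ?thesis
      by (simp add: left frame_comp_chart[OF c])
  qed
  \<comment> \<open>The coefficients frozen at p: the left invariant fields with these values agree
    with X and Y at p.\<close>
  let ?\<xi> = "dL G M (inv\<^bsub>G\<^esub> p) p (X p)" and ?\<eta> = "dL G M (inv\<^bsub>G\<^esub> p) p (Y p)"
  have vals: "left_vf G M ?\<xi> p = X p" "left_vf G M ?\<eta> p = Y p"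
    using dL_inv_dL(2)[OF lie p] by (simp_all add: left_vf_def)
  have "vf_bracket M X Y p =
      vf_bracket M (left_vf G M ?\<xi>) (left_vf G M ?\<eta>) p +
      (dL G M p \<one>\<^bsub>G\<^esub> (frechet_derivative (frame_comp c Y) (at ?x) (X p)) -
      dL G M p \<one>\<^bsub>G\<^esub> (frechet_derivative (frame_comp c X) (at ?x) (Y p)))"
    unfolding vf_bracket_def Let_def c_def[symmetric] vals der[OF X] der[OF Y]
    unfolding left_rep_def[OF lie] by simp
  then show ?thesis
    unfolding vf_bracket_left_vf[OF lie p] using linear_dL[OF lie p one_closed]
    by (simp add: linear_add linear_diff)
qed

lemma left_endo_field_dL:
  assumes "g \<in> carrier G" "h \<in> carrier G"
  shows "left_endo_field G M A (g \<otimes>\<^bsub>G\<^esub> h) (dL G M g h u) = dL G M g h (left_endo_field G M A h u)"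
proof -
  \<comment> \<open>Translating by g and then back from the product to the unit is the same as
    translating back from h.\<close>
  have "dL G M (inv\<^bsub>G\<^esub> (g \<otimes>\<^bsub>G\<^esub> h)) (g \<otimes>\<^bsub>G\<^esub> h) (dL G M g h u) = dL G M (inv\<^bsub>G\<^esub> h) h u"
    using dL_mult[OF lie, of "inv\<^bsub>G\<^esub> (g \<otimes>\<^bsub>G\<^esub> h)" g h u] assms
    by (simp add: inv_mult_group m_assoc)
  then show ?thesis
    unfolding left_endo_field_def using dL_mult[OF lie assms one_closed] assms by simp
qed

lemma left_endo_field_one: "left_endo_field G M A \<one>\<^bsub>G\<^esub> u = A u"
  by (simp add: left_endo_field_def dL_one[OF lie])

lemma frame_comp_left_endo_field:
  assumes c: "c \<in> charts M" and x: "x \<in> snd c ` fst c"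
  shows "frame_comp c (\<lambda>p. left_endo_field G M A p (X p)) x = A (frame_comp c X x)"
proof -
  obtain p where p: "p \<in> fst c" "x = snd c p"
    using x by blast
  moreover have "p \<in> carrier G"
    using p lie_chart_subset[OF lie c] by blast
  ultimately show ?thesis
    using frame_comp_chart[OF c p(1)] dL_inv_dL(1)[OF lie] by (simp add: left_endo_field_def)
qed

lemma smooth_vf_left_endo_field:
  assumes A: "linear A" and X: "smooth_vf M X"
  shows "smooth_vf M (\<lambda>p. left_endo_field G M A p (X p))"
  unfolding smooth_vf_def
proof
  fix c assume c: "c \<in> charts M"
  let ?S = "snd c ` fst c"
  have S: "open ?S"
    by (rule open_chart_range[OF lie_smooth_manifold[OF lie] c])
  have *: "smooth_on ?S (\<lambda>x. A (frame_comp c X x))"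
    using smooth_on_bounded_linear[OF S _ smooth_frame_comp[OF c X]] A linear_conv_bounded_linear by blast
  have "smooth_on ?S (\<lambda>x. left_rep G M c x (A (frame_comp c X x)))"
    by (rule smooth_on_linear_apply[OF S linear_left_rep[OF lie c] smooth_left_rep[OF lie c] *])
  then show "smooth_on ?S (vf_rep M c (\<lambda>p. left_endo_field G M A p (X p)))"
    by (rule smooth_on_cong[OF S])
      (metis frame_comp_left_endo_field[OF c] left_rep_frame_comp[OF c])
qed

lemma left_invariant_complex_structure_left_endo_field:
  assumes A: "linear A" and sq: "\<And>u. A (A u) = - u"
    and nij: "\<And>u v. lie_algebra_bracket G M (A u) (A v) - A (lie_algebra_bracket G M (A u) v)
      - A (lie_algebra_bracket G M u (A v)) - lie_algebra_bracket G M u v = 0"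
  shows "left_invariant_complex_structure G M (left_endo_field G M A)"
proof -
  let ?J = "left_endo_field G M A"
  note sm = lie_smooth_manifold[OF lie]
  have lin: "linear (?J p)" if "p \<in> carrier G" for p
    using linear_compose[OF linear_compose[OF linear_dL[OF lie, of "inv\<^bsub>G\<^esub> p" p] A] linear_dL[OF lie that one_closed]]
      that by (simp add: left_endo_field_def[abs_def] o_def)
  have Jsq: "?J p (?J p u) = - u" if "p \<in> carrier G" for p u
    using that linear_neg[OF linear_dL[OF lie that one_closed]]
    by (simp add: left_endo_field_def dL_inv_dL[OF lie] sq)
  have "nijenhuis M ?J X Y p = 0" if X: "smooth_vf M X" and Y: "smooth_vf M Y" and p: "p \<in> carrier G" for X Y p
  proof -
    let ?c = "chart_at M p"
    let ?S = "snd ?c ` fst ?c"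
    note c = lie_chart_at[OF lie p]
    have S: "open ?S" "snd ?c p \<in> ?S"
      using open_chart_range[OF sm c(1)] c by auto
    have bA: "bounded_linear A"
      using A linear_conv_bounded_linear by blast
    \<comment> \<open>A does not depend on the point, so it commutes with differentiation of the
      coefficients.\<close>
    have der: "frechet_derivative (frame_comp ?c (\<lambda>p. ?J p (Z p))) (at (snd ?c p)) h =
        A (frechet_derivative (frame_comp ?c Z) (at (snd ?c p)) h)" if Z: "smooth_vf M Z" for Z h
    proof -
      have d: "frame_comp ?c Z differentiable (at (snd ?c p))"
        by (rule smooth_on_differentiable[OF smooth_frame_comp[OF c(1) Z] S(2)])
      have "frechet_derivative (\<lambda>x. A (frame_comp ?c Z x)) (at (snd ?c p)) =
          frechet_derivative (frame_comp ?c (\<lambda>p. ?J p (Z p))) (at (snd ?c p))"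
        by (rule frechet_derivative_transform_within_open[OF
              frechet_derivative_bounded_linear_compose(1)[OF bA d] S])
          (simp add: frame_comp_left_endo_field[OF c(1)])
      then show ?thesis
        using frechet_derivative_bounded_linear_compose(2)[OF bA d, of h] by simp
    qed
    define \<xi> where "\<xi> = dL G M (inv\<^bsub>G\<^esub> p) p (X p)"
    define \<eta> where "\<eta> = dL G M (inv\<^bsub>G\<^esub> p) p (Y p)"
    let ?E = "dL G M p \<one>\<^bsub>G\<^esub>" and ?b = "lie_algebra_bracket G M"
    let ?DX = "frechet_derivative (frame_comp ?c X) (at (snd ?c p))"
    let ?DY = "frechet_derivative (frame_comp ?c Y) (at (snd ?c p))"
    have J\<xi>: "dL G M (inv\<^bsub>G\<^esub> p) p (?J p (X p)) = A \<xi>" and J\<eta>: "dL G M (inv\<^bsub>G\<^esub> p) p (?J p (Y p)) = A \<eta>"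
      using dL_inv_dL(1)[OF lie p] by (simp_all add: left_endo_field_def \<xi>_def \<eta>_def)
    have JE: "?J p (?E u) = ?E (A u)" for u
      using dL_inv_dL(1)[OF lie p] by (simp add: left_endo_field_def)
    note sJ = smooth_vf_left_endo_field[OF A]
    have "nijenhuis M ?J X Y p =
        ?E (?b (A \<xi>) (A \<eta>) + A (?DY (?J p (X p))) - A (?DX (?J p (Y p))))
        - ?E (A (?b (A \<xi>) \<eta> + ?DY (?J p (X p)) - A (?DX (Y p))))
        - ?E (A (?b \<xi> (A \<eta>) + A (?DY (X p)) - ?DX (?J p (Y p))))
        - ?E (?b \<xi> \<eta> + ?DY (X p) - ?DX (Y p))"
      unfolding nijenhuis_def vf_bracket_frame_comp[OF sJ[OF X] sJ[OF Y] p] vf_bracket_frame_comp[OF sJ[OF X] Y p]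
        vf_bracket_frame_comp[OF X sJ[OF Y] p] vf_bracket_frame_comp[OF X Y p] der[OF X] der[OF Y] J\<xi> J\<eta> JE
        \<xi>_def[symmetric] \<eta>_def[symmetric] ..
    \<comment> \<open>Of the eight derivative terms, the four along \<open>?J p (X p)\<close> or
      \<open>?J p (Y p)\<close> cancel in pairs as they stand; the four along \<open>X p\<close> or
      \<open>Y p\<close> cancel once A A = -1 is applied.\<close>
    also have "\<dots> = ?E (?b (A \<xi>) (A \<eta>) - A (?b (A \<xi>) \<eta>) - A (?b \<xi> (A \<eta>)) - ?b \<xi> \<eta>)"
      using linear_dL[OF lie p one_closed] by (simp add: linear_add linear_diff linear_add[OF A] linear_diff[OF A] linear_neg sq)
    also have "\<dots> = 0"
      using nij linear_0[OF linear_dL[OF lie p one_closed]] by simp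
    finally show ?thesis .
  qed
  then have "complex_structure M ?J"
    unfolding complex_structure_def almost_complex_structure_def lie_topspace[OF lie]
    using lin Jsq smooth_vf_left_endo_field[OF A] by blast
  then show ?thesis
    unfolding left_invariant_complex_structure_def using left_endo_field_dL by blast
qed

end

section \<open>The double of a symplectic Lie algebra\<close>

context
  fixes br :: "'g::euclidean_space \<Rightarrow> 'g \<Rightarrow> 'g" and w :: "'g \<Rightarrow> 'g \<Rightarrow> real"
  assumes br_linear: "\<And>x. linear (br x)"
    and br_antisym: "\<And>x y. br x y = - br y x"
    and w_bilinear: "bilinear w"
    and w_alternating: "\<And>x. w x x = 0"
    and w_nondegenerate: "\<And>x. (\<And>y. w x y = 0) \<Longrightarrow> x = 0"
    and w_cocycle: "\<And>x y z. w (br x y) z + w (br y z) x + w (br z x) y = 0"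
begin

lemma w_antisym: "w x y = - w y x"
  using w_alternating[of "x + y"] w_alternating[of x] w_alternating[of y]
  unfolding bilinear_ladd[OF w_bilinear] bilinear_radd[OF w_bilinear] by linarith

lemma flat_apply: "blinfun_apply (flat w x) y = w x y"
proof -
  have "bounded_linear (\<lambda>y. w x y)"
    using w_bilinear by (simp add: bilinear_def linear_conv_bounded_linear)
  then show ?thesis
    by (simp add: flat_def bounded_linear_Blinfun_apply)
qed

lemma coad_apply: "blinfun_apply (coad br x \<alpha>) y = - blinfun_apply \<alpha> (br x y)"
proof -
  have "bounded_linear (br x)"
    using br_linear by (simp add: linear_conv_bounded_linear)
  then have "bounded_linear (\<lambda>y. - blinfun_apply \<alpha> (br x y))"
    by (intro bounded_linear_minus bounded_linear_compose[OF blinfun.bounded_linear_right])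
  then show ?thesis
    by (simp add: coad_def bounded_linear_Blinfun_apply)
qed

lemma linear_flat: "linear (flat w)"
  by (rule linearI; rule blinfun_eqI)
    (simp_all add: flat_apply blinfun.add_left blinfun.scaleR_left
      bilinear_ladd[OF w_bilinear] bilinear_lmul[OF w_bilinear])

lemma flat_add: "flat w (x + y) = flat w x + flat w y"
  and flat_diff: "flat w (x - y) = flat w x - flat w y"
  and flat_minus: "flat w (- x) = - flat w x"
  using linear_add[OF linear_flat] linear_diff[OF linear_flat] linear_neg[OF linear_flat] by auto

lemma inj_flat: "inj (flat w)"
  unfolding linear_injective_0[OF linear_flat]
  by (metis flat_apply w_nondegenerate zero_blinfun.rep_eq)

text \<open>\<open>linear_inj_imp_surj\<close> concerns endomorphisms, while \<open>flat w\<close>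
  maps into the dual. Hence the functional \<open>w x\<close> is replaced by \<open>?T x\<close>,
  the vector that represents it through the inner product.\<close>

lemma surj_flat: "surj (flat w)"
  unfolding surj_def
proof
  fix \<beta> :: "'g \<Rightarrow>\<^sub>L real"
  let ?T = "\<lambda>x. \<Sum>b\<in>Basis. w x b *\<^sub>R b"
  have T_inner: "?T x \<bullet> b = w x b" if "b \<in> Basis" for x b
    using that by (simp add: inner_sum_left_Basis)
  have lin: "linear ?T"
    by (rule linearI)
      (simp_all add: bilinear_ladd[OF w_bilinear] bilinear_lmul[OF w_bilinear] scaleR_add_left
        sum.distrib scaleR_sum_right)
  have basis_ext: "f = g" if "linear f" "linear g" "\<And>b. b \<in> Basis \<Longrightarrow> f b = g b" for f g :: "'g \<Rightarrow> real"
    using linear_eq_stdbasis[OF that] .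
  have "inj ?T"
    unfolding linear_injective_0[OF lin]
  proof (intro allI impI)
    fix x assume "?T x = 0"
    then have "w x b = 0" if "b \<in> Basis" for b
      using T_inner[OF that, of x] by simp
    then have "w x = (\<lambda>_. 0)"
      using w_bilinear by (intro basis_ext linear_zero) (auto simp: bilinear_def)
    then show "x = 0"
      using w_nondegenerate by metis
  qed
  then have "surj ?T"
    by (rule linear_inj_imp_surj[OF lin])
  then obtain x where x: "(\<Sum>b\<in>Basis. blinfun_apply \<beta> b *\<^sub>R b) = ?T x"
    by (rule surjE)
  have "w x b = blinfun_apply \<beta> b" if "b \<in> Basis" for b
    using T_inner[OF that, of x] that unfolding x[symmetric] by (simp add: inner_sum_left_Basis)
  then have "w x = blinfun_apply \<beta>"
    using w_bilinear by (intro basis_ext) (auto simp: bilinear_def blinfun.bounded_linear_right bounded_linear.linear)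
  then show "\<exists>x. \<beta> = flat w x"
    by (intro exI[of _ x] blinfun_eqI) (simp add: flat_apply)
qed

abbreviation sharp :: "('g \<Rightarrow>\<^sub>L real) \<Rightarrow> 'g" where
  "sharp \<equiv> inv_into UNIV (flat w)"

lemma sharp_flat [simp]: "sharp (flat w x) = x"
  by (rule inv_f_f[OF inj_flat])

lemma flat_sharp [simp]: "flat w (sharp \<alpha>) = \<alpha>"
  by (rule surj_f_inv_f[OF surj_flat])

text \<open>The left symmetric product of a symplectic Lie algebra: the coadjoint action
  transported to the Lie algebra by \<^term>\<open>flat w\<close>. It expresses the whole double bracket.\<close>

definition lsp :: "'g \<Rightarrow> 'g \<Rightarrow> 'g" where
  "lsp a b = sharp (coad br a (flat w b))"

lemma flat_lsp: "flat w (lsp a b) = coad br a (flat w b)"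
  by (simp add: lsp_def)

lemma w_lsp: "w (lsp a b) z = - w b (br a z)"
  by (metis coad_apply flat_apply flat_lsp)

lemma br_eq_lsp: "br a b = lsp a b - lsp b a"
proof (rule injD[OF inj_flat], rule blinfun_eqI)
  fix z
  have "w (br a b) z = w a (br b z) - w b (br a z)"
    using w_cocycle[of a b z] w_antisym[of "br b z" a] w_antisym[of "br z a" b] br_antisym[of z a]
      bilinear_rneg[OF w_bilinear, of b "br a z"] by simp
  then show "blinfun_apply (flat w (br a b)) z = blinfun_apply (flat w (lsp a b - lsp b a)) z"
    by (simp add: flat_apply flat_diff blinfun.diff_left w_lsp)
qed

text \<open>Compatibility with signs is what the torsion computation asks of \<open>lsp\<close>: J
  exchanges the two components up to one minus sign.\<close>

lemma lsp_minus_left: "lsp (- a) b = - lsp a b"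
proof (rule injD[OF inj_flat], rule blinfun_eqI)
  fix z
  have "br (- a) z = - br a z"
    using br_antisym linear_neg[OF br_linear] by metis
  then show "blinfun_apply (flat w (lsp (- a) b)) z = blinfun_apply (flat w (- lsp a b)) z"
    by (simp add: flat_apply flat_minus blinfun.minus_left w_lsp bilinear_rneg[OF w_bilinear])
qed

lemma lsp_minus_right: "lsp a (- b) = - lsp a b"
proof (rule injD[OF inj_flat], rule blinfun_eqI)
  show "blinfun_apply (flat w (lsp a (- b))) z = blinfun_apply (flat w (- lsp a b)) z" for z
    by (simp add: flat_apply flat_minus blinfun.minus_left w_lsp bilinear_lneg[OF w_bilinear])
qed

lemma dual_bracket_flat: "dual_bracket br sharp (flat w a) (flat w b) = flat w (br a b)"
  by (simp add: dual_bracket_def br_eq_lsp[of a b] flat_diff flat_lsp)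

text \<open>\<open>flat w\<close> is an isomorphism from the Lie algebra onto its dual with the
  bracket of r, and it is minus its own transpose. Hence it turns the coadjoint action of the dual
  on the Lie algebra into that of the Lie algebra on its dual, which is \<open>lsp\<close>
  again.\<close>

lemma dual_coad_flat: "dual_coad br sharp (flat w a) y = lsp a y"
  unfolding dual_coad_def
proof (rule the_equality)
  have eq: "blinfun_apply \<beta> (lsp a y) = - blinfun_apply (dual_bracket br sharp (flat w a) \<beta>) y" for \<beta>
  proof -
    have "blinfun_apply \<beta> (lsp a y) = w (sharp \<beta>) (lsp a y)"
      using flat_apply[of "sharp \<beta>"] by simp
    also have "\<dots> = w y (br a (sharp \<beta>))"
      using w_antisym[of "sharp \<beta>"] w_lsp by simp
    also have "\<dots> = - blinfun_apply (flat w (br a (sharp \<beta>))) y"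
      using w_antisym[of y "br a (sharp \<beta>)"] by (simp add: flat_apply)
    finally show ?thesis
      using dual_bracket_flat[of a "sharp \<beta>"] by simp
  qed
  then show "\<forall>\<beta>. blinfun_apply \<beta> (lsp a y) = - blinfun_apply (dual_bracket br sharp (flat w a) \<beta>) y"
    by blast
  \<comment> \<open>Uniqueness: testing against the functionals \<open>flat w x\<close> suffices, by
    nondegeneracy.\<close>
  fix z assume z: "\<forall>\<beta>. blinfun_apply \<beta> z = - blinfun_apply (dual_bracket br sharp (flat w a) \<beta>) y"
  have "w (z - lsp a y) x = 0" for x
  proof -
    have "w x z = w x (lsp a y)"
      using z eq flat_apply by metis
    then show ?thesis
      using w_antisym[of "z - lsp a y" x] by (simp add: bilinear_rsub[OF w_bilinear])
  qed
  then show "z = lsp a y"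
    using w_nondegenerate[of "z - lsp a y"] by simp
qed

text \<open>Both components have the same shape: writing \<open>lsp\<close> as a dot, with s = x + a
  and t = y + b they are s.y - t.x and s.b - t.a.\<close>

lemma double_bracket_flat:
  "double_bracket br sharp (x, flat w a) (y, flat w b) =
    (lsp x y - lsp y x + lsp a y - lsp b x,
     flat w (lsp a b - lsp b a + lsp x b - lsp y a))"
  by (simp add: double_bracket_def dual_coad_flat dual_bracket_flat flat_lsp flat_add flat_diff br_eq_lsp)

lemma double_J_flat: "double_J w (x, flat w a) = (- a, flat w x)"
  by (simp add: double_J_def)

lemma linear_double_J: "linear (double_J w)"
proof (rule linearI)
  have add: "sharp (\<alpha> + \<beta>) = sharp \<alpha> + sharp \<beta>" for \<alpha> \<beta>
    by (rule injD[OF inj_flat]) (simp add: flat_add)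
  have scale: "sharp (r *\<^sub>R \<alpha>) = r *\<^sub>R sharp \<alpha>" for r \<alpha>
    by (rule injD[OF inj_flat]) (simp add: linear_scale[OF linear_flat])
  show "double_J w (u + v) = double_J w u + double_J w v" for u v
    by (cases u; cases v) (simp add: double_J_def add flat_add)
  show "double_J w (r *\<^sub>R u) = r *\<^sub>R double_J w u" for r u
    by (cases u) (simp add: double_J_def scale linear_scale[OF linear_flat])
qed

lemma double_J_double_J: "double_J w (double_J w u) = - u"
proof (cases u)
  case (Pair x \<alpha>)
  then show ?thesis
    using double_J_flat[of x "sharp \<alpha>"] double_J_flat[of "- sharp \<alpha>" x] by (simp add: flat_minus)
qed

text \<open>Let s(u) be the sum of the two components of u, acting componentwise by
  \<open>lsp\<close>; this action commutes with J. So [Ju,Jv] = J(s(Ju).v - s(Jv).u), and both terms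
  cancel against terms of J[Ju,v] and J[u,Jv]. By J J = -1, what remains of -J[Ju,v] - J[u,Jv] is
  s(u).v - s(v).u, which is [u,v].\<close>

lemma double_J_integrable:
  "double_bracket br sharp (double_J w u) (double_J w v)
    - double_J w (double_bracket br sharp (double_J w u) v)
    - double_J w (double_bracket br sharp u (double_J w v))
    - double_bracket br sharp u v = 0"
proof -
  obtain x a where u: "u = (x, flat w a)"
    by (metis flat_sharp surj_pair)
  obtain y b where v: "v = (y, flat w b)"
    by (metis flat_sharp surj_pair)
  show ?thesis
    unfolding u v double_J_flat double_bracket_flat lsp_minus_left lsp_minus_right
    by (simp add: flat_add flat_diff flat_minus zero_prod_def)
qed

end

section \<open>From the symplectic form to the cocycle identity\<close>

lemma symplectic_lie_algebra:
  assumes "symplectic_lie_group G M w"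
  defines "br \<equiv> lie_algebra_bracket G M" and "\<omega> \<equiv> w \<one>\<^bsub>G\<^esub>"
  shows "bilinear \<omega>" "\<omega> x x = 0" "(\<And>y. \<omega> x y = 0) \<Longrightarrow> x = 0"
    "\<omega> (br x y) z + \<omega> (br y z) x + \<omega> (br z x) y = 0"
proof -
  have lie: "lie_group G M" and sym: "symplectic_form M w"
    and inv: "\<And>g h u v. g \<in> carrier G \<Longrightarrow> h \<in> carrier G \<Longrightarrow>
      w (g \<otimes>\<^bsub>G\<^esub> h) (dL G M g h u) (dL G M g h v) = w h u v"
    using assms(1) by (auto simp: symplectic_lie_group_def)
  interpret group G
    using lie by (simp add: lie_group_def)
  have one: "\<one>\<^bsub>G\<^esub> \<in> topspace (mtop M)"
    by (simp add: lie_topspace[OF lie])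
  show bil: "bilinear \<omega>" and "\<omega> x x = 0"
    using sym one unfolding symplectic_form_def smooth_2form_def \<omega>_def by blast+
  show "x = 0" if "\<And>y. \<omega> x y = 0"
    using that sym one unfolding symplectic_form_def \<omega>_def by blast
  \<comment> \<open>Each p is the translate of the unit by p itself, so left invariance reduces the
    pairing to its value at the unit.\<close>
  have const: "w p (left_vf G M u p) (left_vf G M v p) = w \<one>\<^bsub>G\<^esub> u v" if "p \<in> topspace (mtop M)" for p u v
    using inv[of p "\<one>\<^bsub>G\<^esub>" u v] that by (simp add: lie_topspace[OF lie] left_vf_def)
  have "ext_deriv2 M w (left_vf G M x) (left_vf G M y) (left_vf G M z) \<one>\<^bsub>G\<^esub> = 0"
    using sym one smooth_left_vf[OF lie] unfolding symplectic_form_def by blast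
  \<comment> \<open>The bracket terms of \<open>ext_deriv2\<close>; antisymmetry of the bracket then
    brings them to cyclic form.\<close>
  then have "- \<omega> (br x y) z + \<omega> (br x z) y - \<omega> (br y z) x = 0"
    unfolding ext_deriv2_def
    using dir_deriv_const[OF lie_smooth_manifold[OF lie] one const]
    by (simp add: left_vf_one[OF lie] \<omega>_def br_def lie_algebra_bracket_def)
  moreover have "br x z = - br z x"
    unfolding br_def by (rule lie_algebra_bracket_antisym[OF lie])
  ultimately show "\<omega> (br x y) z + \<omega> (br y z) x + \<omega> (br z x) y = 0"
    by (simp add: bilinear_lneg[OF bil])
qed

text \<open>The Lie algebra of H lives on the model type 'd, so its being the double is expressed by
  a linear bijection \<phi> that intertwines the brackets. The endomorphism is accordingly
  \<open>double_J\<close> conjugated by \<phi>.\<close>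

theorem proposition3p0p2:
  fixes G :: "'a monoid" and M :: "('a, 'g::euclidean_space) manifold"
    and w :: "'a \<Rightarrow> 'g \<Rightarrow> 'g \<Rightarrow> real"
    and H :: "'b monoid" and N :: "('b, 'd::euclidean_space) manifold"
    and \<phi> :: "'d \<Rightarrow> 'g \<times> ('g \<Rightarrow>\<^sub>L real)"
  assumes "symplectic_lie_group G M w"
    and "lie_group H N"
    and "linear \<phi>" and "bij \<phi>"
    and "\<And>u v. \<phi> (lie_algebra_bracket H N u v) = symplectic_double_bracket G M w (\<phi> u) (\<phi> v)"
  shows "let J = left_endo_field H N (inv_into UNIV \<phi> \<circ> double_J (w \<one>\<^bsub>G\<^esub>) \<circ> \<phi>)
         in left_invariant_complex_structure H N J \<and>
            (\<forall>u. \<phi> (J \<one>\<^bsub>H\<^esub> u) = double_J (w \<one>\<^bsub>G\<^esub>) (\<phi> u))"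
proof -
  have lieG: "lie_group G M"
    using assms(1) by (simp add: symplectic_lie_group_def)
  let ?\<omega> = "w \<one>\<^bsub>G\<^esub>" and ?br = "lie_algebra_bracket G M"
  note alg = linear_lie_algebra_bracket[OF lieG] lie_algebra_bracket_antisym[OF lieG]
    symplectic_lie_algebra[OF assms(1)]
  let ?B = "double_bracket ?br (inv_into UNIV (flat ?\<omega>))" and ?K = "double_J ?\<omega>"
  define A where "A = inv_into UNIV \<phi> \<circ> ?K \<circ> \<phi>"
  have K: "linear ?K" "\<And>u. ?K (?K u) = - u"
    and nij: "\<And>u v. ?B (?K u) (?K v) - ?K (?B (?K u) v) - ?K (?B u (?K v)) - ?B u v = 0"
    using linear_double_J[of ?br ?\<omega>] double_J_double_J[of ?br ?\<omega>] double_J_integrable[of ?br ?\<omega>] alg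
    by blast+
  have \<phi>A: "\<phi> (A u) = ?K (\<phi> u)" for u
    using surj_f_inv_f[OF bij_is_surj[OF assms(4)]] by (simp add: A_def)
  have inj: "\<phi> u = \<phi> v \<Longrightarrow> u = v" for u v
    using injD[OF bij_is_inj[OF assms(4)]] .
  have br: "\<phi> (lie_algebra_bracket H N u v) = ?B (\<phi> u) (\<phi> v)" for u v
    using assms(5) by (simp add: symplectic_double_bracket_def)
  \<comment> \<open>The conditions on A are checked after applying the injective map \<phi>, under
    which A becomes \<open>double_J\<close>.\<close>
  have "linear A"
    by (rule linearI; rule inj)
      (simp_all add: \<phi>A linear_add[OF assms(3)] linear_scale[OF assms(3)] linear_add[OF K(1)] linear_scale[OF K(1)])
  moreover have "A (A u) = - u" for u
    by (rule inj) (simp add: \<phi>A K linear_neg[OF assms(3)])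
  moreover have "lie_algebra_bracket H N (A u) (A v) - A (lie_algebra_bracket H N (A u) v)
      - A (lie_algebra_bracket H N u (A v)) - lie_algebra_bracket H N u v = 0" for u v
    by (rule inj) (simp add: linear_diff[OF assms(3)] linear_0[OF assms(3)] \<phi>A br nij)
  ultimately have "left_invariant_complex_structure H N (left_endo_field H N A)"
    by (rule left_invariant_complex_structure_left_endo_field[OF assms(2)])
  then show ?thesis
    unfolding A_def[symmetric] Let_def using \<phi>A left_endo_field_one[OF assms(2)] by simp
qed

end
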